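(* Let $T=z^4+p_2z^2+p_0$ and $Q=z^2+q_1z+q_0$ define the torus $\mathcal{T}$ and the quadric $\mathcal{Q}$ as in the context, and let $\mathcal{C}_{\mathbb{R}}=\mathcal{T}\cap\mathcal{Q}$. Suppose $q_1\not\equiv 0$. Let $f\in\mathbb{R}[x,y]$ be an irreducible multiple factor of $\widetilde{\mathbf{S}_0}$ (i.e. $f^2\mid\widetilde{\mathbf{S}_0}$) contributing a one-dimensional subset to the cutcurve $\Pi_z(\mathcal{C}_{\mathbb{R}})$. Then: 1. If $f=kq_1$ with $k\in\mathbb{R}$, then $q_1(0,0)=0$, and the segment of the line $q_1=0$ contained in $\mathcal{A}_{\mathcal{T},\mathcal{Q}}$ corresponds to the projection under $\Pi_z$ of a meridian circle contained in $\mathcal{C}_{\mathbb{R}}$. 2. Otherwise, the curve defined by $f$ can be lifted via $z=-\dfrac{sres_{1,0}(x,y)}{sres_1(x,y)}$ to a component of $\mathcal{C}_{\mathbb{R}}$ along which the intersection of $\mathcal{T}$ and $\mathcal{Q}$ is tangential.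
   Context: Fix real numbers $0<r<R$. Put $p_2(x,y)=2(R^2-r^2+x^2+y^2)$, $p_0(x,y)=(R^2+2Rr+r^2-x^2-y^2)(R^2-2Rr+r^2-x^2-y^2)$, $T=z^4+p_2z^2+p_0\in\mathbb{R}[x,y,z]$, and $\mathcal{T}=\{T=0\}\subset\mathbb{R}^3$ (a ring torus). Let $q_1=ex+fy+i$ and $q_0=ax^2+by^2+dxy+gx+hy+j$ with real coefficients (the coefficient $f$ here is unrelated to the polynomial $f$ of the claim), $Q=z^2+q_1z+q_0$, and $\mathcal{Q}=\{Q=0\}\subset\mathbb{R}^3$. Standing assumption: the quadric is irreducible, i.e. neither the square of a plane nor the union of two planes. $\Pi_z(x,y,z)=(x,y)$; the cutcurve is the set $\Pi_z(\mathcal{C}_{\mathbb{R}})$. $\widetilde{\mathbf{S}_0}\in\mathbb{R}[x,y]$ is the resultant of $T$ and $Q$ with respect to $z$, explicitly $\widetilde{\mathbf{S}_0}=(q_0q_1^2+p_2q_0-q_0^2-p_0)^2+q_1^2(q_1^2+p_2-2q_0)(p_0-q_0^2)$. Also $sres_1=q_1(q_1^2+p_2-2q_0)$ and $sres_{1,0}=q_0q_1^2+p_2q_0-q_0^2-p_0$ are the coefficients of the first subresultant polynomial $sres_1\,z+sres_{1,0}$ of $T$ and $Q$ with respect to $z$. With $\Delta_{\mathcal{T}}=p_0$ and $\Delta_{\mathcal{Q}}=q_1^2-4q_0$, $\mathcal{A}_{\mathcal{T},\mathcal{Q}}=\{(x,y)\in\mathbb{R}^2:\Delta_{\mathcal{T}}(x,y)\le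 0,\ \Delta_{\mathcal{Q}}(x,y)\ge 0\}$. $f$ contributes a one-dimensional subset to the cutcurve if $\{f=0\}\cap\Pi_z(\mathcal{C}_{\mathbb{R}})$ has dimension one. A meridian circle of $\mathcal{T}$ is one of the two circles of radius $r$ in which a plane containing the $z$-axis cuts $\mathcal{T}$ (a vertical cross-sectional circle). The intersection is tangential along a component if the Jacobian matrix of $T$ and $Q$ has rank one at its points. *)

theory Defs
  imports "Subresultants.Subresultant" "HOL-Analysis.Analysis"
begin

no_notation Matrix.vec_index (infixl "$" 100)

section \<open>Polynomials and their real zero sets\<close>

text \<open>\<open>real poly poly\<close> is R[x,y], the outer variable being y, and \<open>real poly poly poly\<close>
  is R[x,y][z], the outermost variable being z.\<close>

definition cst :: "real \<Rightarrow> real poly poly" where "cst c = [:[:c:]:]"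
definition var_x :: "real poly poly" where "var_x = [:[:0, 1:]:]"
definition var_y :: "real poly poly" where "var_y = [:0, 1:]"

definition eval2 :: "real poly poly \<Rightarrow> real^2 \<Rightarrow> real" where
  "eval2 g v = poly (poly g [:v$2:]) (v$1)"

definition eval3 :: "real poly poly poly \<Rightarrow> real^3 \<Rightarrow> real" where
  "eval3 g v = poly (poly (poly g [:[:v$3:]:]) [:v$2:]) (v$1)"

definition curve :: "real poly poly \<Rightarrow> (real^2) set" where
  "curve g = {v. eval2 g v = 0}"

definition surface :: "real poly poly poly \<Rightarrow> (real^3) set" where
  "surface g = {v. eval3 g v = 0}"

definition Pi_z :: "real^3 \<Rightarrow> real^2" where
  "Pi_z v = vector [v$1, v$2]"

lemma eval2_simps [simp]:
  "eval2 (cst c) v = c" "eval2 var_x v = v$1" "eval2 var_y v = v$2"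
  "eval2 0 v = 0" "eval2 1 v = 1" "eval2 (numeral m) v = numeral m"
  "eval2 (g + h) v = eval2 g v + eval2 h v" "eval2 (g - h) v = eval2 g v - eval2 h v"
  "eval2 (- g) v = - eval2 g v"
  "eval2 (g * h) v = eval2 g v * eval2 h v" "eval2 (g ^ n) v = eval2 g v ^ n"
  by (simp_all add: eval2_def cst_def var_x_def var_y_def)

lemma eval3_pCons [simp]:
  "eval3 0 v = 0" "eval3 (pCons c g) v = eval2 c (Pi_z v) + v$3 * eval3 g v"
  by (simp_all add: eval3_def eval2_def Pi_z_def)

section \<open>The torus, the quadric and their intersection\<close>

definition p2 :: "real \<Rightarrow> real \<Rightarrow> real poly poly" where
  "p2 R r = cst 2 * (cst (R^2 - r^2) + var_x^2 + var_y^2)"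

definition p0 :: "real \<Rightarrow> real \<Rightarrow> real poly poly" where
  "p0 R r = (cst (R^2 + 2*R*r + r^2) - var_x^2 - var_y^2)
          * (cst (R^2 - 2*R*r + r^2) - var_x^2 - var_y^2)"

definition torus_poly :: "real \<Rightarrow> real \<Rightarrow> real poly poly poly" where
  "torus_poly R r = [:p0 R r, 0, p2 R r, 0, 1:]"

definition quadric_poly :: "real poly poly \<Rightarrow> real poly poly \<Rightarrow> real poly poly poly" where
  "quadric_poly q1 q0 = [:q0, q1, 1:]"

definition intersection :: "real \<Rightarrow> real \<Rightarrow> real poly poly \<Rightarrow> real poly poly \<Rightarrow> (real^3) set" where
  "intersection R r q1 q0 = surface (torus_poly R r) \<inter> surface (quadric_poly q1 q0)"

definition cutcurve :: "real \<Rightarrow> real \<Rightarrow> real poly poly \<Rightarrow> real poly poly \<Rightarrow> (real^2) set" where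
  "cutcurve R r q1 q0 = Pi_z ` intersection R r q1 q0"

text \<open>The set \<open>\<A>\<^sub>T\<^sub>,\<^sub>Q\<close> given by \<open>\<Delta>\<^sub>T \<le> 0 \<le> \<Delta>\<^sub>Q\<close>.\<close>

definition region :: "real \<Rightarrow> real \<Rightarrow> real poly poly \<Rightarrow> real poly poly \<Rightarrow> (real^2) set" where
  "region R r q1 q0 = {v. eval2 (p0 R r) v \<le> 0 \<and> eval2 (q1^2 - 4*q0) v \<ge> 0}"

text \<open>One of the two circles of radius \<open>r\<close> in which a plane through the z-axis cuts the torus.
  A circle is written as the intersection of the plane with a sphere centred on the plane.\<close>

definition meridian_circle :: "real \<Rightarrow> real \<Rightarrow> (real^3) set \<Rightarrow> bool" where
  "meridian_circle R r M \<longleftrightarrow>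
     (\<exists>n b P c c'. n \<noteq> 0 \<and> P = {v. n \<bullet> v = b} \<and> {v. v$1 = 0 \<and> v$2 = 0} \<subseteq> P \<and>
        c \<in> P \<and> c' \<in> P \<and> c \<noteq> c' \<and>
        surface (torus_poly R r) \<inter> P = (sphere c r \<inter> P) \<union> (sphere c' r \<inter> P) \<and>
        M = sphere c r \<inter> P)"

section \<open>Resultant and first subresultant with respect to z\<close>

definition S0 :: "real \<Rightarrow> real \<Rightarrow> real poly poly \<Rightarrow> real poly poly \<Rightarrow> real poly poly" where
  "S0 R r q1 q0 = resultant (torus_poly R r) (quadric_poly q1 q0)"

definition sres1 :: "real \<Rightarrow> real \<Rightarrow> real poly poly \<Rightarrow> real poly poly \<Rightarrow> real poly poly" where
  "sres1 R r q1 q0 = coeff (subresultant 1 (torus_poly R r) (quadric_poly q1 q0)) 1"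

definition sres10 :: "real \<Rightarrow> real \<Rightarrow> real poly poly \<Rightarrow> real poly poly \<Rightarrow> real poly poly" where
  "sres10 R r q1 q0 = coeff (subresultant 1 (torus_poly R r) (quadric_poly q1 q0)) 0"

lemma torus_mod_quadric:
  "torus_poly R r + - [:q1^2 + p2 R r - q0, - q1, 1:] * quadric_poly q1 q0
     = [:- (q0*q1^2 + p2 R r*q0 - q0^2 - p0 R r), - (q1*(q1^2 + p2 R r - 2*q0)):]"
  by (simp add: torus_poly_def quadric_poly_def algebra_simps power2_eq_square)

lemma jnf_det_2:
  "Determinant.det (Matrix.mat 2 2 f) = f (0,0) * f (1,1) - f (0,1) * (f (1,0) :: 'a :: comm_ring_1)"
  by (simp add: laplace_expansion_column[of _ 2 0] Determinant.cofactor_def mat_delete_def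
      det_single numeral_2_eq_2 lessThan_Suc)

lemma jnf_det_3:
  "Determinant.det (Matrix.mat 3 3 f) = f (0,0) * (f (1,1) * f (2,2) - f (1,2) * f (2,1))
  - f (1,0) * (f (0,1) * f (2,2) - f (0,2) * f (2,1))
  + f (2,0) * (f (0,1) * f (1,2) - f (0,2) * (f (1,1) :: 'a :: comm_ring_1))"
  by (simp add: laplace_expansion_column[of _ 3 0] Determinant.cofactor_def mat_delete_def
      jnf_det_2[unfolded numeral_2_eq_2] numeral_2_eq_2 numeral_3_eq_3
      lessThan_Suc algebra_simps)

lemma resultant_quadratic_linear:
  fixes a b u v :: "'a :: idom"
  assumes "v \<noteq> 0"
  shows "resultant [:a, b, 1:] [:u, v:] = u^2 - b * u * v + a * v^2"
proof -
  have deg: "degree [:a, b, 1:] = 2" "degree [:u, v:] = 1" "2 + 1 = (3::nat)" using assms by simp_all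
  show ?thesis
    unfolding resultant_def sylvester_mat_def sylvester_mat_sub_def deg jnf_det_3
    by (simp add: numeral_2_eq_2 numeral_3_eq_3 algebra_simps)
qed

lemma quartic_quadratic_subresultants:
  fixes F G B :: "'a :: idom poly"
  assumes eq: "F + B * G = [:u, v:]" and F: "degree F = 4" and G: "G = [:a, b, 1:]"
  shows "subresultant 1 F G = [:- u, - v:]"
    and "resultant F G = u^2 - b * u * v + a * v^2"
proof -
  have dG: "degree G = 2" and lG: "lead_coeff G = 1" using G by simp_all
  have G2: "coeff G 2 = 1" using dG lG by simp
  have le: "degree G \<le> degree F" and lt: "degree G > degree [:u, v:]"
    using F dG by simp_all
  from BT_lemma_1_15[OF eq le] lt
  have "subresultant (degree G - 1) F G
      = smult ((- 1) ^ (degree F - degree G + 1) * lead_coeff G ^ (degree F - degree G + 1)) [:u, v:]"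
    by blast
  thus "subresultant 1 F G = [:- u, - v:]"
    unfolding F dG by (simp add: G2)
  have "[: resultant F G :] = [:u^2 - b * u * v + a * v^2:]"
  proof (cases "v = 0")
    case True
    hence "degree [:u, v:] \<le> 0" "0 < degree G" using dG by simp_all
    with BT_eq_19[OF eq le, of 0] lt
    have "subresultant 0 F G = smult ((- 1) ^ ((degree F - 0) * (degree G - 0))
        * lead_coeff G ^ (degree F - 0) * coeff [:u, v:] 0 ^ (degree G - 0 - 1)) [:u, v:]"
      by blast
    thus ?thesis
      unfolding subresultant_resultant F dG G2 using True by (simp add: power2_eq_square)
  next
    case False
    hence d: "degree [:u, v:] = 1" by simp
    with BT_lemma_1_12[OF eq le, of 0] lt
    have "subresultant 0 F G = smult ((- 1) ^ ((degree F - 0) * (degree G - 0))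
        * lead_coeff G ^ (degree F - degree [:u, v:])) (subresultant 0 G [:u, v:])"
      by simp
    thus ?thesis
      unfolding subresultant_resultant F dG G2 d
      using resultant_quadratic_linear[OF False, of a b u] G by simp
  qed
  thus "resultant F G = u^2 - b * u * v + a * v^2" by simp
qed

lemma
  shows sres1_explicit: "sres1 R r q1 q0 = q1 * (q1^2 + p2 R r - 2*q0)"
    and sres10_explicit: "sres10 R r q1 q0 = q0*q1^2 + p2 R r*q0 - q0^2 - p0 R r"
    and S0_explicit: "S0 R r q1 q0 = (q0*q1^2 + p2 R r*q0 - q0^2 - p0 R r)^2
       + q1^2 * (q1^2 + p2 R r - 2*q0) * (p0 R r - q0^2)"
proof -
  have T: "degree (torus_poly R r) = 4" by (simp add: torus_poly_def)
  note sub = quartic_quadratic_subresultants[OF torus_mod_quadric[of R r q1 q0] T quadric_poly_def]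
  show "sres1 R r q1 q0 = q1 * (q1^2 + p2 R r - 2*q0)"
    and "sres10 R r q1 q0 = q0*q1^2 + p2 R r*q0 - q0^2 - p0 R r"
    unfolding sres1_def sres10_def sub(1) by simp_all
  have id: "(- u)^2 - q1 * (- u) * (- (q1 * w)) + q0 * (- (q1 * w))^2 = u^2 + q1^2 * w * (P0 - q0^2)"
    if "u = q0*q1^2 + P2*q0 - q0^2 - P0" "w = q1^2 + P2 - 2*q0" for u w P0 P2
  proof -
    have *: "P0 - q0^2 = q0 * w - u" unfolding that by (simp add: algebra_simps power2_eq_square)
    show ?thesis unfolding * by (simp add: algebra_simps power2_eq_square)
  qed
  show "S0 R r q1 q0 = (q0*q1^2 + p2 R r*q0 - q0^2 - p0 R r)^2
       + q1^2 * (q1^2 + p2 R r - 2*q0) * (p0 R r - q0^2)"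
    unfolding S0_def sub(2) by (rule id) (rule refl)+
qed

section \<open>Zariski topology and dimension\<close>

definition zariski_closed :: "'a::euclidean_space set \<Rightarrow> bool" where
  "zariski_closed Z \<longleftrightarrow>
     (\<exists>G. (\<forall>g\<in>G. real_polynomial_function g) \<and> Z = {v. \<forall>g\<in>G. g v = 0})"

definition zariski_closure :: "'a::euclidean_space set \<Rightarrow> 'a set" where
  "zariski_closure S = \<Inter>{Z. zariski_closed Z \<and> S \<subseteq> Z}"

definition zariski_irreducible :: "'a::euclidean_space set \<Rightarrow> bool" where
  "zariski_irreducible Z \<longleftrightarrow> zariski_closed Z \<and> Z \<noteq> {} \<and>
     (\<forall>A B. zariski_closed A \<and> zariski_closed B \<and> Z = A \<union> B \<longrightarrow> Z = A \<or> Z = B)"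

definition irreducible_component :: "'a::euclidean_space set \<Rightarrow> 'a set \<Rightarrow> bool" where
  "irreducible_component K C \<longleftrightarrow> zariski_irreducible K \<and> K \<subseteq> C \<and>
     (\<forall>Z. zariski_irreducible Z \<and> K \<subseteq> Z \<and> Z \<subseteq> C \<longrightarrow> Z = K)"

text \<open>The dimension of a semialgebraic set is the Krull dimension of its Zariski closure.\<close>

definition irreducible_chain :: "'a::euclidean_space set \<Rightarrow> nat \<Rightarrow> bool" where
  "irreducible_chain S n \<longleftrightarrow>
     (\<exists>Z. (\<forall>i\<le>n. zariski_irreducible (Z i) \<and> Z i \<subseteq> zariski_closure S) \<and>
          (\<forall>i<n. Z i \<subset> Z (Suc i)))"

definition has_dimension :: "'a::euclidean_space set \<Rightarrow> nat \<Rightarrow> bool" where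
  "has_dimension S n \<longleftrightarrow> irreducible_chain S n \<and> \<not> irreducible_chain S (Suc n)"

section \<open>Lifting and tangency\<close>

definition lift :: "real \<Rightarrow> real \<Rightarrow> real poly poly \<Rightarrow> real poly poly \<Rightarrow> real^2 \<Rightarrow> real^3" where
  "lift R r q1 q0 v =
     vector [v$1, v$2, - (eval2 (sres10 R r q1 q0) v / eval2 (sres1 R r q1 q0) v)]"

definition tangential_at :: "real \<Rightarrow> real \<Rightarrow> real poly poly \<Rightarrow> real poly poly \<Rightarrow> real^3 \<Rightarrow> bool" where
  "tangential_at R r q1 q0 v \<longleftrightarrow>
     rank (jacobian
       (\<lambda>w. vector [eval3 (torus_poly R r) w, eval3 (quadric_poly q1 q0) w] :: real^2) (at v)) = 1"

end

theory Submission
  imports Defs "Subresultants.Subresultant_Gcd" "HOL-Computational_Algebra.Field_as_Ring"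
begin

no_notation Matrix.vec_index (infixl "$" 100)

text \<open>
  Write \<open>T\<close> and \<open>Q\<close> for the torus and the quadric and \<open>L = sres1 * z + sres10\<close> for their first
  subresultant. Everything rests on two division identities: \<open>T\<close> is \<open>- L\<close> modulo \<open>Q\<close>
  (\<open>torus_division\<close>), and \<open>sres1^2 * Q\<close> is the resultant modulo \<open>L\<close> (\<open>quadric_elimination\<close>). Here
  \<open>sres1 = q1 * (q1^2 + p2 - 2 q0)\<close>.

  Suppose first that \<open>f\<close> is a multiple of \<open>q1\<close>. On the line \<open>q1 = 0\<close> the resultant is \<open>sres10^2\<close>, so
  \<open>sres10\<close> vanishes there: the two heights \<open>z\<close> with \<open>z^2 = - q0\<close> satisfy the torus equation along the
  whole line. That equation exhibits \<open>4 R^2 \<rho>^2\<close>, with \<open>\<rho>\<close> the distance from the origin, as the square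
  of a polynomial on the line. This is only possible if the line passes through the origin, and then
  \<open>q0\<close> is determined on it and \<open>Q\<close> restricts to the equation of a meridian circle
  (\<open>line_with_vanishing_sres10\<close>, \<open>meridian_over_line\<close>).

  Otherwise \<open>f\<close> does not divide \<open>q1\<close>. If it divided the other factor of \<open>sres1\<close>, then \<open>Q\<close> would divide
  \<open>T\<close> over every point of \<open>f = 0\<close>; for a ring torus this can only happen over the origin, a positivity
  argument (\<open>common_quadratic_factor_only_over_origin\<close>). As the curve \<open>f = 0\<close> is infinite, \<open>f\<close> does
  not divide \<open>sres1\<close>, and \<open>sres1\<close> has only finitely many zeros on the curve. Let \<open>K\<close> be the
  Zariski closure of the lift of the remaining points. It is irreducible because \<open>f\<close> is prime and
  has infinitely many real zeros, and it is a maximal irreducible subset of the intersection because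
  the latter lies over the zeros of the resultant, which is not the zero polynomial
  (\<open>lifted_curve_is_component\<close>). Since \<open>f^2\<close> divides the resultant, differentiating the two identities
  shows that the gradients of \<open>T\<close> and \<open>Q\<close> are proportional at lifted points; this extends to the
  closure, and the rank is exactly one because the torus is smooth (\<open>tangential_on_lifted_curve\<close>).
\<close>

section \<open>Common zeros of plane polynomials\<close>

text \<open>Elimination of \<open>y\<close> without passing to the field of rational functions in \<open>x\<close>: an element
  of least \<open>y\<close>-degree in the ideal generated by \<open>f\<close> and \<open>g\<close> divides, up to a factor depending on
  \<open>x\<close> alone, every other element of the ideal. If its degree were positive, primality would make
  \<open>f\<close> a factor of it, and then a factor of \<open>g\<close>.\<close>

lemma eliminant_of_irreducible:
  fixes f g :: "real poly poly"
  assumes f: "irreducible f" and nd: "\<not> f dvd g"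
  obtains a b c where "c \<noteq> 0" "a * f + b * g = [:c:]"
proof -
  have prime: "prime_elem f" using f by (rule irreducible_imp_prime_elem)
  have f0: "f \<noteq> 0" using f by auto
  define I where "I = {h. \<exists>a b. h = a * f + b * g}"
  have fI: "f \<in> I" and gI: "g \<in> I"
    by (auto simp: I_def intro: exI[of _ 1] exI[of _ 0])
  have "\<exists>h. h \<in> I \<and> h \<noteq> 0" using fI f0 by blast
  then obtain h where h: "h \<in> I" "h \<noteq> 0"
    and least: "\<And>k. k \<in> I \<Longrightarrow> k \<noteq> 0 \<Longrightarrow> degree h \<le> degree k"
    using ex_has_least_nat[of "\<lambda>h. h \<in> I \<and> h \<noteq> 0" _ degree] by blast
  obtain a b where hab: "h = a * f + b * g" using h(1) unfolding I_def by blast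
  have divides: "\<exists>c q. c \<noteq> 0 \<and> smult c k = h * q" if kI: "k \<in> I" for k
  proof -
    obtain c q where cq: "c \<noteq> 0" "smult c k = h * q + pseudo_mod k h"
      using pseudo_mod(1)[OF h(2)] by blast
    obtain a' b' where k: "k = a' * f + b' * g" using kI unfolding I_def by blast
    have "pseudo_mod k h = smult c k - h * q" using cq(2) by simp
    also have "\<dots> = ([:c:] * a' - q * a) * f + ([:c:] * b' - q * b) * g"
      unfolding k hab by (simp add: algebra_simps smult_add_right)
    finally have "pseudo_mod k h \<in> I" unfolding I_def by blast
    hence "pseudo_mod k h = 0"
      using least[of "pseudo_mod k h"] pseudo_mod(2)[OF h(2), of k] by linarith
    thus ?thesis using cq by auto
  qed
  have "degree h = 0"
  proof (rule ccontr)
    assume deg: "degree h \<noteq> 0"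
    obtain c k where ck: "c \<noteq> 0" "smult c f = h * k"
      using divides[OF fI] by blast
    have "f dvd h * k" unfolding ck(2)[symmetric] by (simp add: dvd_smult)
    hence "f dvd h"
    proof (rule prime_elem_dvd_multD[OF prime, THEN disjE])
      assume "f dvd k"
      then obtain k' where "k = f * k'" by (elim dvdE)
      hence "f * [:c:] = f * (h * k')" using ck(2) by (simp add: ac_simps)
      hence "[:c:] = h * k'" using f0 by (metis mult_left_cancel)
      moreover have "k' \<noteq> 0" using calculation ck(1) by auto
      ultimately have "degree h + degree k' = 0"
        using h(2) by (metis degree_mult_eq degree_pCons_0)
      thus "f dvd h" using deg by simp
    qed
    moreover obtain c' k' where c': "c' \<noteq> 0" "smult c' g = h * k'" using divides[OF gI] by blast
    ultimately have "f dvd [:c':] * g" by (simp add: dvd_mult2)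
    hence "f dvd [:c':]" using prime nd prime_elem_dvd_multD by blast
    hence "degree f = 0" using c'(1) dvd_imp_degree_le[of f "[:c':]"] by simp
    thus False using least[OF fI f0] deg by simp
  qed
  then obtain c where hc: "h = [:c:]" by (rule degree_eq_zeroE)
  show ?thesis
  proof (rule that)
    show "c \<noteq> 0" using h(2) hc by auto
    show "a * f + b * g = [:c:]" using hab hc by simp
  qed
qed

lemma poly_slice: "poly (map_poly (\<lambda>p. poly p x) g) y = poly (poly g [:y:]) (x::real)"
  by (induction g) (simp_all add: map_poly_pCons)

text \<open>A polynomial vanishing on the whole line over \<open>x\<close> has a linear factor depending on the first
  variable alone, and \<open>f\<close> would be associated to that factor.\<close>

lemma finite_vertical_slice:
  fixes f g :: "real poly poly"
  assumes f: "irreducible f" and nd: "\<not> f dvd g"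
  shows "finite {y. poly (poly f [:y:]) x = 0 \<and> poly (poly g [:y:]) x = 0}"
proof -
  have vanish: "[:[:- x, 1:]:] dvd h" if "map_poly (\<lambda>p. poly p x) h = 0" for h :: "real poly poly"
    unfolding const_poly_dvd_iff
  proof
    fix n
    have "poly (coeff h n) x = coeff (map_poly (\<lambda>p. poly p x) h) n" by (simp add: coeff_map_poly)
    thus "[:- x, 1:] dvd coeff h n" using that by (simp add: poly_eq_0_iff_dvd)
  qed
  have "map_poly (\<lambda>p. poly p x) f \<noteq> 0 \<or> map_poly (\<lambda>p. poly p x) g \<noteq> 0"
  proof (rule ccontr)
    assume "\<not> ?thesis"
    hence xf: "[:[:- x, 1:]:] dvd f" and xg: "[:[:- x, 1:]:] dvd g" using vanish by auto
    obtain k where k: "f = [:[:- x, 1:]:] * k" using xf by (elim dvdE)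
    have "\<not> is_unit [:[:- x, 1:]:]" by (simp add: is_unit_const_poly_iff is_unit_pCons_iff)
    hence "is_unit k" using irreducibleD[OF f k] by blast
    hence "f dvd [:[:- x, 1:]:]" unfolding k by (subst mult_unit_dvd_iff) (rule dvd_refl | assumption)+
    thus False using xg nd dvd_trans by blast
  qed
  hence "finite {y. poly (map_poly (\<lambda>p. poly p x) f) y = 0}
      \<or> finite {y. poly (map_poly (\<lambda>p. poly p x) g) y = 0}"
    using poly_roots_finite by blast
  thus ?thesis unfolding poly_slice by (auto elim: rev_finite_subset)
qed

lemma vec2_eqI: "v$1 = w$1 \<Longrightarrow> v$2 = w$2 \<Longrightarrow> v = (w::real^2)"
  by (simp add: vec_eq_iff forall_2)
lemma vec3_eqI: "v$1 = w$1 \<Longrightarrow> v$2 = w$2 \<Longrightarrow> v$3 = w$3 \<Longrightarrow> v = (w::real^3)"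
  by (simp add: vec_eq_iff forall_3)

text \<open>The part of the theorem of Bezout that is used: the eliminant leaves finitely many
  abscissas, and over each of them there are finitely many points.\<close>

lemma finite_common_zeros:
  assumes f: "irreducible f" and nd: "\<not> f dvd g"
  shows "finite (curve f \<inter> curve g)"
proof -
  obtain a b c where c: "c \<noteq> 0" and abc: "a * f + b * g = [:c:]"
    using eliminant_of_irreducible[OF assms] .
  let ?Y = "\<lambda>x. {y. poly (poly f [:y:]) x = 0 \<and> poly (poly g [:y:]) x = 0}"
  let ?P = "\<Union>x\<in>{x. poly c x = 0}. (\<lambda>y. vector [x, y] :: real^2) ` ?Y x"
  have "curve f \<inter> curve g \<subseteq> ?P"
  proof
    fix v assume v: "v \<in> curve f \<inter> curve g"
    have "poly c (v$1) = eval2 (a * f + b * g) v" unfolding abc by (simp add: eval2_def)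
    also have "\<dots> = 0" using v by (simp add: curve_def)
    finally have "poly c (v$1) = 0" .
    moreover have "v$2 \<in> ?Y (v$1)" using v by (simp add: curve_def eval2_def)
    moreover have "v = vector [v$1, v$2]" by (rule vec2_eqI) simp_all
    ultimately show "v \<in> ?P" by blast
  qed
  moreover have "finite ?P"
    using poly_roots_finite[OF c] finite_vertical_slice[OF assms] by blast
  ultimately show ?thesis by (rule finite_subset)
qed

text \<open>A real Nullstellensatz for plane curves: an irreducible polynomial with infinitely many real
  zeros generates the ideal of any infinite subset of its curve.\<close>

corollary dvd_if_vanishing_on_infinite:
  assumes "irreducible f" "infinite (curve f \<inter> curve g)"
  shows "f dvd g"
  using finite_common_zeros assms by blast

section \<open>The Zariski topology\<close>

lemmas real_polynomial_function_intros =
  real_polynomial_function.intros(2-4) real_polynomial_function_diff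

lemma real_polynomial_function_component: "real_polynomial_function (\<lambda>v::real^'n. v$i)"
  by (rule real_polynomial_function.intros(1)) (rule bounded_linear_vec_nth)

lemma real_polynomial_function_poly:
  assumes "real_polynomial_function p"
  shows "real_polynomial_function (\<lambda>v. poly c (p v))"
  by (induction c) (simp_all add: assms real_polynomial_function_intros)

lemma real_polynomial_function_poly2:
  assumes "real_polynomial_function p" "real_polynomial_function q"
  shows "real_polynomial_function (\<lambda>v. poly (poly g [:q v:]) (p v))"
  by (induction g)
     (simp_all add: assms real_polynomial_function_intros real_polynomial_function_poly)

lemma real_polynomial_function_eval2_Pi_z: "real_polynomial_function (\<lambda>w. eval2 g (Pi_z w))"
  unfolding eval2_def Pi_z_def
  by (simp add: real_polynomial_function_poly2 real_polynomial_function_component)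

lemma real_polynomial_function_eval3: "real_polynomial_function (eval3 g)"
proof (induction g)
  case (pCons c g)
  have "eval3 (pCons c g) = (\<lambda>w. eval2 c (Pi_z w) + w$3 * eval3 g w)" by (rule ext) simp
  thus ?case
    using pCons.IH by (simp add: real_polynomial_function_intros
      real_polynomial_function_eval2_Pi_z real_polynomial_function_component)
next
  case 0
  have "eval3 0 = (\<lambda>w. 0)" by (rule ext) simp
  thus ?case by (simp add: real_polynomial_function_intros)
qed

lemma zariski_closed_zeros:
  "real_polynomial_function g \<Longrightarrow> zariski_closed {v. g v = 0}"
  unfolding zariski_closed_def by (rule exI[of _ "{g}"]) simp

text \<open>This turns every later use of the Zariski closure into: polynomial equations valid on \<open>S\<close>
  stay valid on the closure.\<close>

lemma mem_zariski_closure_iff: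
  "v \<in> zariski_closure S \<longleftrightarrow>
    (\<forall>g. real_polynomial_function g \<longrightarrow> (\<forall>s\<in>S. g s = 0) \<longrightarrow> g v = 0)" (is "?L = ?R")
proof
  assume L: ?L
  show ?R
  proof (intro allI impI)
    fix g :: "'a \<Rightarrow> real" assume g: "real_polynomial_function g" "\<forall>s\<in>S. g s = 0"
    hence "zariski_closed {v. g v = 0}" "S \<subseteq> {v. g v = 0}" by (auto intro: zariski_closed_zeros)
    thus "g v = 0" using L unfolding zariski_closure_def by blast
  qed
next
  assume R: ?R
  show ?L unfolding zariski_closure_def
  proof clarify
    fix Z assume "zariski_closed Z" and S: "S \<subseteq> Z"
    then obtain G where G: "\<forall>g\<in>G. real_polynomial_function g" "Z = {v. \<forall>g\<in>G. g v = 0}"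
      unfolding zariski_closed_def by blast
    show "v \<in> Z" using R G S by blast
  qed
qed

lemma subset_zariski_closure: "S \<subseteq> zariski_closure S"
  unfolding zariski_closure_def by blast

lemma zariski_closure_minimal: "zariski_closed Z \<Longrightarrow> S \<subseteq> Z \<Longrightarrow> zariski_closure S \<subseteq> Z"
  unfolding zariski_closure_def by blast

lemma zariski_closed_closure: "zariski_closed (zariski_closure S)"
  unfolding zariski_closed_def
  by (rule exI[of _ "{g. real_polynomial_function g \<and> (\<forall>s\<in>S. g s = 0)}"])
     (auto simp: mem_zariski_closure_iff)

lemma zariski_closed_Int:
  assumes "zariski_closed A" "zariski_closed B" shows "zariski_closed (A \<inter> B)"
proof -
  obtain G H where "\<forall>g\<in>G. real_polynomial_function g" "A = {v. \<forall>g\<in>G. g v = 0}"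
    "\<forall>g\<in>H. real_polynomial_function g" "B = {v. \<forall>g\<in>H. g v = 0}"
    using assms unfolding zariski_closed_def by blast
  thus ?thesis unfolding zariski_closed_def by (intro exI[of _ "G \<union> H"]) auto
qed

lemma zariski_closed_Un:
  assumes "zariski_closed A" "zariski_closed B" shows "zariski_closed (A \<union> B)"
proof -
  obtain G H where G: "\<forall>g\<in>G. real_polynomial_function g" "A = {v. \<forall>g\<in>G. g v = 0}"
    and H: "\<forall>g\<in>H. real_polynomial_function g" "B = {v. \<forall>g\<in>H. g v = 0}"
    using assms unfolding zariski_closed_def by blast
  let ?P = "{\<lambda>v. g v * h v |g h. g \<in> G \<and> h \<in> H}"
  have "\<forall>p\<in>?P. real_polynomial_function p" using G(1) H(1) by auto
  moreover have "A \<union> B = {v. \<forall>p\<in>?P. p v = 0}"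
    unfolding G(2) H(2) by (auto, metis mult_eq_0_iff)
  ultimately show ?thesis unfolding zariski_closed_def by blast
qed

lemma zariski_closed_finite: "finite S \<Longrightarrow> zariski_closed S"
proof (induction S rule: finite_induct)
  case empty
  show ?case unfolding zariski_closed_def by (rule exI[of _ "{\<lambda>_. 1}"]) auto
next
  case (insert p S)
  have "zariski_closed {p}" unfolding zariski_closed_def
  proof (intro exI conjI)
    show "\<forall>g\<in>range (\<lambda>u v. (v - p) \<bullet> u). real_polynomial_function g"
    proof
      fix g assume "g \<in> range (\<lambda>u v. (v - p) \<bullet> u)"
      then obtain u where g: "g = (\<lambda>v. (v - p) \<bullet> u)" by (rule rangeE)
      show "real_polynomial_function g" unfolding g inner_diff_left
        by (intro real_polynomial_function_diff real_polynomial_function.intros(1,2)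
            bounded_linear_inner_left)
    qed
    have eq: "v = p" if "\<And>u. (v - p) \<bullet> u = 0" for v
      using that[of "v - p"] by simp
    show "{p} = {v. \<forall>g\<in>range (\<lambda>u v. (v - p) \<bullet> u). g v = 0}"
      by (auto intro!: eq)
  qed
  thus ?case using zariski_closed_Un[OF _ insert.IH, of "{p}"] by simp
qed

text \<open>If the closure were the union of two proper closed subsets, each of them would miss a point of
  \<open>S\<close>; equations detecting these two misses have a product that vanishes on \<open>S\<close>.\<close>

lemma zariski_irreducible_closureI:
  assumes ne: "S \<noteq> {}"
    and prime: "\<And>g h. real_polynomial_function g \<Longrightarrow> real_polynomial_function h \<Longrightarrow>
      \<forall>s\<in>S. g s * h s = 0 \<Longrightarrow> (\<forall>s\<in>S. g s = 0) \<or> (\<forall>s\<in>S. h s = 0)"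
  shows "zariski_irreducible (zariski_closure S)"
  unfolding zariski_irreducible_def
proof (intro conjI allI impI)
  show "zariski_closed (zariski_closure S)" by (rule zariski_closed_closure)
  show "zariski_closure S \<noteq> {}" using ne subset_zariski_closure by blast
  fix A B :: "'a set" assume AB: "zariski_closed A \<and> zariski_closed B \<and> zariski_closure S = A \<union> B"
  show "zariski_closure S = A \<or> zariski_closure S = B"
  proof (rule ccontr)
    assume "\<not> ?thesis"
    hence "\<not> S \<subseteq> A" "\<not> S \<subseteq> B" using AB zariski_closure_minimal by blast+
    then obtain s t where s: "s \<in> S" "s \<notin> A" and t: "t \<in> S" "t \<notin> B" by blast
    obtain g where g: "real_polynomial_function g" "g s \<noteq> 0" "\<forall>v\<in>A. g v = 0"
      using AB s(2) unfolding zariski_closed_def by blast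
    obtain h where h: "real_polynomial_function h" "h t \<noteq> 0" "\<forall>v\<in>B. h v = 0"
      using AB t(2) unfolding zariski_closed_def by blast
    have "\<forall>v\<in>S. g v * h v = 0"
      using AB subset_zariski_closure[of S] g(3) h(3) by auto
    thus False using prime[OF g(1) h(1)] g(2) h(2) s(1) t(1) by blast
  qed
qed

lemma zariski_irreducible_subset_cases:
  assumes "zariski_irreducible Z" "zariski_closed A" "zariski_closed B" "Z \<subseteq> A \<union> B"
  shows "Z \<subseteq> A \<or> Z \<subseteq> B"
proof -
  have "zariski_closed Z" using assms(1) unfolding zariski_irreducible_def by blast
  hence "zariski_closed (Z \<inter> A)" "zariski_closed (Z \<inter> B)"
    using assms(2,3) by (auto intro: zariski_closed_Int)
  moreover have "Z = (Z \<inter> A) \<union> (Z \<inter> B)" using assms(4) by blast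
  ultimately have "Z = Z \<inter> A \<or> Z = Z \<inter> B"
    using assms(1) unfolding zariski_irreducible_def by blast
  thus ?thesis by blast
qed

lemma zariski_irreducible_finite_singleton:
  assumes Z: "zariski_irreducible Z" and fin: "finite Z"
  obtains p where "Z = {p}"
proof -
  obtain p where p: "p \<in> Z" using Z unfolding zariski_irreducible_def by blast
  have "Z \<subseteq> {p} \<or> Z \<subseteq> Z - {p}"
    by (rule zariski_irreducible_subset_cases[OF Z]) (use fin in \<open>auto intro: zariski_closed_finite\<close>)
  thus ?thesis using p that by blast
qed

text \<open>A finite set is closed, and its
  irreducible subsets are singletons, which admit no strict chains.\<close>

lemma infinite_if_has_dimension_1:
  assumes "has_dimension S 1" shows "infinite S"
proof
  assume fin: "finite S"
  hence "zariski_closure S \<subseteq> S" by (intro zariski_closure_minimal zariski_closed_finite) auto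
  moreover obtain Z where Z: "\<forall>i\<le>1. zariski_irreducible (Z i) \<and> Z i \<subseteq> zariski_closure S"
    "\<forall>i<1. Z i \<subset> Z (Suc i)"
    using assms unfolding has_dimension_def irreducible_chain_def by blast
  ultimately have sub: "Z 1 \<subseteq> S" by (meson order.trans order_refl)
  have Z1: "zariski_irreducible (Z 1)" using Z(1) by blast
  have "Z 0 \<subset> Z 1" using Z(2)[rule_format, of 0] by simp
  have "Z 0 \<noteq> {}" using Z(1)[rule_format, of 0] by (simp add: zariski_irreducible_def)
  obtain p where "Z 1 = {p}" using zariski_irreducible_finite_singleton[OF Z1 finite_subset[OF sub fin]] .
  thus False using \<open>Z 0 \<subset> Z 1\<close> \<open>Z 0 \<noteq> {}\<close> by auto
qed

section \<open>Derivatives of polynomial functions\<close>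

text \<open>Directional derivatives are again polynomial functions of the point, so that proportionality
  of two gradients is a Zariski closed condition.\<close>

lemma real_polynomial_function_has_derivative:
  fixes p :: "'a::real_normed_vector \<Rightarrow> real"
  assumes "real_polynomial_function p"
  shows "\<exists>p'. (\<forall>w. (p has_derivative p' w) (at w)) \<and>
    (\<forall>h. real_polynomial_function (\<lambda>w. p' w h))"
  using assms
proof (induction p rule: real_polynomial_function.induct)
  case (linear f)
  thus ?case by (intro exI[of _ "\<lambda>_. f"]) (auto intro: bounded_linear_imp_has_derivative)
next
  case (const c)
  show ?case by (intro exI[of _ "\<lambda>_ _. 0"]) (auto intro: real_polynomial_function.intros(2))
next
  case (add f g)
  then obtain f' g' where
    "\<forall>w. (f has_derivative f' w) (at w)" "\<forall>h. real_polynomial_function (\<lambda>w. f' w h)"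
    "\<forall>w. (g has_derivative g' w) (at w)" "\<forall>h. real_polynomial_function (\<lambda>w. g' w h)"
    by blast
  thus ?case
    by (intro exI[of _ "\<lambda>w h. f' w h + g' w h"]) (auto intro: has_derivative_add)
next
  case (mult f g)
  then obtain f' g' where
    "\<forall>w. (f has_derivative f' w) (at w)" "\<forall>h. real_polynomial_function (\<lambda>w. f' w h)"
    "\<forall>w. (g has_derivative g' w) (at w)" "\<forall>h. real_polynomial_function (\<lambda>w. g' w h)"
    by blast
  thus ?case using mult.hyps
    by (intro exI[of _ "\<lambda>w h. f w * g' w h + f' w h * g w"]) (auto intro!: has_derivative_mult real_polynomial_function_intros)
qed

section \<open>The first subresultant and the intersection\<close>

text \<open>The first subresultant polynomial \<open>sres1 * z + sres10\<close> as a function on space. Away from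
  \<open>sres1 = 0\<close> its zero set is the graph of \<open>lift\<close>.\<close>

definition subresultant_at ::
  "real \<Rightarrow> real \<Rightarrow> real poly poly \<Rightarrow> real poly poly \<Rightarrow> real^3 \<Rightarrow> real" where
  "subresultant_at R r q1 q0 w
     = eval2 (sres1 R r q1 q0) (Pi_z w) * w$3 + eval2 (sres10 R r q1 q0) (Pi_z w)"

lemma eval3_1 [simp]: "eval3 1 w = 1"
  by (simp add: eval3_def)

lemma eval3_torus_poly:
  "eval3 (torus_poly R r) w
     = (w$3)^4 + eval2 (p2 R r) (Pi_z w) * (w$3)^2 + eval2 (p0 R r) (Pi_z w)"
  by (simp add: torus_poly_def power4_eq_xxxx power2_eq_square algebra_simps)

lemma eval3_quadric_poly:
  "eval3 (quadric_poly q1 q0) w = (w$3)^2 + eval2 q1 (Pi_z w) * w$3 + eval2 q0 (Pi_z w)"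
  by (simp add: quadric_poly_def power2_eq_square algebra_simps)

lemma eval3_torus_cartesian:
  "eval3 (torus_poly R r) w
     = ((w$1)^2 + (w$2)^2 + (w$3)^2 + R^2 - r^2)^2 - 4 * R^2 * ((w$1)^2 + (w$2)^2)"
  by (simp add: eval3_torus_poly p2_def p0_def Pi_z_def power4_eq_xxxx power2_eq_square algebra_simps)

text \<open>Up to sign the first subresultant is the remainder of the torus polynomial modulo the quadric,
  because the quadric is monic in \<open>z\<close>.\<close>

lemma torus_division:
  "eval3 (torus_poly R r) w
     = ((w$3)^2 - eval2 q1 (Pi_z w) * w$3 + eval2 (q1^2 + p2 R r - q0) (Pi_z w))
         * eval3 (quadric_poly q1 q0) w
       - subresultant_at R r q1 q0 w"
  by (simp add: eval3_torus_poly eval3_quadric_poly subresultant_at_def sres1_explicit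
      sres10_explicit power4_eq_xxxx power2_eq_square algebra_simps)

text \<open>The value of the quadric at the root \<open>- sres10 / sres1\<close> of the first subresultant, with the
  denominator \<open>sres1^2\<close> cleared.\<close>

lemma S0_via_subresultant:
  "S0 R r q1 q0 = (sres10 R r q1 q0)^2 - q1 * sres10 R r q1 q0 * sres1 R r q1 q0
     + q0 * (sres1 R r q1 q0)^2"
proof -
  define W where "W = q1^2 + p2 R r - 2*q0"
  have *: "p0 R r - q0^2 = q0 * W - sres10 R r q1 q0"
    by (simp add: W_def sres10_explicit power2_eq_square algebra_simps)
  have "S0 R r q1 q0 = (sres10 R r q1 q0)^2 + q1^2 * W * (p0 R r - q0^2)"
    by (simp add: S0_explicit sres10_explicit W_def)
  also have "\<dots> = (sres10 R r q1 q0)^2 - q1 * sres10 R r q1 q0 * (q1 * W) + q0 * (q1 * W)^2"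
    unfolding * by (simp add: power2_eq_square algebra_simps)
  finally show ?thesis by (simp add: sres1_explicit W_def)
qed

text \<open>Division with remainder in the other direction: modulo the first subresultant, the quadric
  times \<open>sres1^2\<close> is the resultant. Together with \<open>torus_division\<close> this transfers zeros, and
  multiplicities of zeros, between the resultant and the intersection.\<close>

lemma quadric_elimination:
  "(eval2 (sres1 R r q1 q0) (Pi_z w))^2 * eval3 (quadric_poly q1 q0) w
     = eval2 (S0 R r q1 q0) (Pi_z w)
       + subresultant_at R r q1 q0 w
         * (subresultant_at R r q1 q0 w - 2 * eval2 (sres10 R r q1 q0) (Pi_z w)
            + eval2 (q1 * sres1 R r q1 q0) (Pi_z w))"
  unfolding subresultant_at_def S0_via_subresultant eval3_quadric_poly eval2_simps
  by (simp add: power2_eq_square algebra_simps)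

lemma mem_intersection_iff:
  "w \<in> intersection R r q1 q0 \<longleftrightarrow>
     eval3 (torus_poly R r) w = 0 \<and> eval3 (quadric_poly q1 q0) w = 0"
  by (simp add: intersection_def surface_def)

lemma subresultant_vanishes_on_intersection:
  assumes "w \<in> intersection R r q1 q0"
  shows "subresultant_at R r q1 q0 w = 0"
proof -
  have zero: "eval3 (torus_poly R r) w = 0" "eval3 (quadric_poly q1 q0) w = 0"
    using assms by (simp_all add: mem_intersection_iff)
  show ?thesis using torus_division[of R r w q1 q0] unfolding zero by simp
qed

lemma resultant_vanishes_on_intersection:
  assumes "w \<in> intersection R r q1 q0"
  shows "eval2 (S0 R r q1 q0) (Pi_z w) = 0"
proof -
  have zero: "eval3 (quadric_poly q1 q0) w = 0"
    using assms by (simp add: mem_intersection_iff)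
  show ?thesis
    using quadric_elimination[of R r q1 q0 w]
    unfolding zero subresultant_vanishes_on_intersection[OF assms] by simp
qed

lemma Pi_z_lift [simp]: "Pi_z (lift R r q1 q0 v) = v"
  by (rule vec2_eqI) (simp_all add: Pi_z_def lift_def)

lemma lift_3:
  "lift R r q1 q0 v $ 3 = - (eval2 (sres10 R r q1 q0) v / eval2 (sres1 R r q1 q0) v)"
  by (simp add: lift_def)

lemma subresultant_vanishes_on_lift:
  assumes "eval2 (sres1 R r q1 q0) v \<noteq> 0"
  shows "subresultant_at R r q1 q0 (lift R r q1 q0 v) = 0"
  using assms by (simp add: lift_3 subresultant_at_def)

lemma lift_in_intersection:
  assumes s: "eval2 (sres1 R r q1 q0) v \<noteq> 0" and S: "eval2 (S0 R r q1 q0) v = 0"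
  shows "lift R r q1 q0 v \<in> intersection R r q1 q0"
proof -
  let ?w = "lift R r q1 q0 v"
  have "(eval2 (sres1 R r q1 q0) v)^2 * eval3 (quadric_poly q1 q0) ?w = 0"
    using quadric_elimination[of R r q1 q0 ?w]
    unfolding subresultant_vanishes_on_lift[OF s] Pi_z_lift S by simp
  hence Q: "eval3 (quadric_poly q1 q0) ?w = 0" using s by simp
  have "eval3 (torus_poly R r) ?w = 0"
    unfolding torus_division[of R r ?w q1 q0] Q subresultant_vanishes_on_lift[OF s] by simp
  thus ?thesis using Q by (simp add: mem_intersection_iff)
qed

lemma eq_lift_if_subresultant_vanishes:
  assumes "subresultant_at R r q1 q0 w = 0" and "eval2 (sres1 R r q1 q0) (Pi_z w) \<noteq> 0"
  shows "w = lift R r q1 q0 (Pi_z w)"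
proof (rule vec3_eqI)
  show "w$3 = lift R r q1 q0 (Pi_z w) $ 3"
    using assms by (simp add: lift_3 subresultant_at_def field_simps eq_neg_iff_add_eq_0)
qed (simp_all add: lift_def Pi_z_def)

lemma finite_intersection_fibre:
  "finite {w \<in> intersection R r q1 q0. Pi_z w = v}"
proof -
  let ?P = "[:eval2 q0 v, eval2 q1 v, 1:]"
  have "{w \<in> intersection R r q1 q0. Pi_z w = v}
      \<subseteq> (\<lambda>z. vector [v$1, v$2, z]) ` {z. poly ?P z = 0}" (is "?A \<subseteq> ?B")
  proof
    fix w assume w: "w \<in> ?A"
    hence "poly ?P (w$3) = 0"
      by (auto simp: mem_intersection_iff eval3_quadric_poly power2_eq_square algebra_simps)
    moreover have "w = vector [v$1, v$2, w$3]" using w by (intro vec3_eqI) (auto simp: Pi_z_def)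
    ultimately show "w \<in> ?B" by blast
  qed
  moreover have "finite ?B" by (intro finite_imageI poly_roots_finite) simp
  ultimately show ?thesis by (rule finite_subset)
qed

section \<open>Tangency at lifted points\<close>

text \<open>The torus is smooth. With \<open>E = |w|^2 + R^2 - r^2\<close>, which is positive and satisfies
  \<open>E^2 = 4 R^2 \<rho>^2\<close> on the torus (\<open>\<rho>\<close> being the distance to the axis), a vanishing vertical derivative
  forces \<open>z = 0\<close> and a vanishing radial derivative forces \<open>E = 2 R^2\<close>, that is \<open>\<rho> = R\<close>; but these
  are the points of the core circle, which has distance \<open>r > 0\<close> from the torus.\<close>

lemma gradient_torus_nonzero:
  assumes R: "0 < r" "r < R" and w: "eval3 (torus_poly R r) w = 0"
    and der: "(eval3 (torus_poly R r) has_derivative T') (at w)"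
  shows "\<exists>h. T' h \<noteq> 0"
proof (rule ccontr)
  assume "\<not> ?thesis"
  hence zero: "T' h = 0" for h by blast
  define E where "E = (w$1)^2 + (w$2)^2 + (w$3)^2 + R^2 - r^2"
  have comp: "((\<lambda>w::real^3. w$i) has_derivative (\<lambda>h. h$i)) (at w)" for i
    by (rule bounded_linear_imp_has_derivative) (rule bounded_linear_vec_nth)
  have "((\<lambda>w::real^3. ((w$1)^2 + (w$2)^2 + (w$3)^2 + R^2 - r^2)^2 - 4 * R^2 * ((w$1)^2 + (w$2)^2))
    has_derivative (\<lambda>h. 4 * E * (w$1 * h$1 + w$2 * h$2 + w$3 * h$3)
      - 8 * R^2 * (w$1 * h$1 + w$2 * h$2))) (at w)"
    by (rule derivative_eq_intros comp refl)+ (simp add: E_def algebra_simps)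
  hence "T' = (\<lambda>h. 4 * E * (w$1 * h$1 + w$2 * h$2 + w$3 * h$3) - 8 * R^2 * (w$1 * h$1 + w$2 * h$2))"
    using has_derivative_unique[OF der] by (simp add: eval3_torus_cartesian[abs_def])
  note T' = this
  have R2: "r^2 < R^2" using R by (intro power_strict_mono) auto
  have E: "E > 0" unfolding E_def using R2 by (smt (verit) zero_le_power2)
  have EE: "E^2 = 4 * R^2 * ((w$1)^2 + (w$2)^2)"
    using w by (simp add: eval3_torus_cartesian E_def)
  have w3: "w$3 = 0" using zero[of "vector [0, 0, 1]"] E by (simp add: T')
  have "4 * (E - 2 * R^2) * ((w$1)^2 + (w$2)^2) = 0"
    using zero[of "vector [w$1, w$2, 0]"] by (simp add: T' power2_eq_square algebra_simps)
  moreover have "(w$1)^2 + (w$2)^2 \<noteq> 0" using EE E by auto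
  ultimately have "4 * (E - 2 * R^2) = 0" using mult_eq_0_iff by blast
  hence E2: "E = 2 * R^2" by simp
  hence "4 * R^2 * R^2 = 4 * R^2 * ((w$1)^2 + (w$2)^2)" using EE by (simp add: power2_eq_square)
  hence "(w$1)^2 + (w$2)^2 = R^2" using R by simp
  thus False using E2 w3 R by (simp add: E_def)
qed

lemma rank_jacobian_pair_eq_1:
  fixes p q :: "real^'n \<Rightarrow> real"
  assumes p: "(p has_derivative p') (at w)" and q: "(q has_derivative q') (at w)"
    and h0: "p' h0 \<noteq> 0" and par: "\<And>h k. p' h * q' k = p' k * q' h"
  shows "rank (jacobian (\<lambda>w. vector [p w, q w] :: real^2) (at w)) = 1"
proof -
  let ?F = "\<lambda>w. vector [p w, q w] :: real^2"
  have vec: "vector [s, t] = s *\<^sub>R axis 1 1 + t *\<^sub>R (axis 2 1 :: real^2)" for s t :: real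
    by (rule vec2_eqI) (simp_all add: axis_def)
  have D: "(?F has_derivative (\<lambda>h. vector [p' h, q' h])) (at w)"
    unfolding vec by (intro has_derivative_add has_derivative_scaleR_left p q)
  hence "linear (\<lambda>h. vector [p' h, q' h] :: real^2)" by (rule has_derivative_linear)
  moreover have "jacobian ?F (at w) = matrix (\<lambda>h. vector [p' h, q' h])"
    unfolding jacobian_def using frechet_derivative_at[OF D] by simp
  ultimately have J: "jacobian ?F (at w) *v h = vector [p' h, q' h]" for h
    by (simp add: matrix_works)
  define c where "c = q' h0 / p' h0"
  have lin: "linear p'" using p by (rule has_derivative_linear)
  have q': "q' h = c * p' h" for h using par[of h h0] h0 by (simp add: c_def field_simps)
  have "range (\<lambda>h. jacobian ?F (at w) *v h) = span {vector [1, c]}"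
  proof (intro equalityI subsetI)
    fix v assume "v \<in> range (\<lambda>h. jacobian ?F (at w) *v h)"
    then obtain h where v: "v = vector [p' h, q' h]" using J by auto
    have "v = p' h *\<^sub>R vector [1, c]" unfolding v q' by (rule vec2_eqI) simp_all
    thus "v \<in> span {vector [1, c]}" by (auto simp: span_singleton)
  next
    fix v :: "real^2" assume "v \<in> span {vector [1, c]}"
    then obtain t where t: "v = t *\<^sub>R vector [1, c]" by (auto simp: span_singleton)
    have "p' ((t / p' h0) *\<^sub>R h0) = t" using h0 by (simp add: linear_scale[OF lin])
    hence "v = vector [p' ((t / p' h0) *\<^sub>R h0), q' ((t / p' h0) *\<^sub>R h0)]"
      unfolding t q' by (intro vec2_eqI) simp_all
    thus "v \<in> range (\<lambda>h. jacobian ?F (at w) *v h)" unfolding J by blast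
  qed
  moreover have "vector [1, c] \<noteq> (0 :: real^2)"
  proof
    assume "vector [1, c] = (0 :: real^2)"
    hence "(vector [1, c] :: real^2) $ 1 = 0" by simp
    thus False by simp
  qed
  ultimately show ?thesis by (simp add: rank_dim_range)
qed

text \<open>Differentiating the two division identities at a lifted point kills all terms that carry a factor
  vanishing there. Since \<open>f^2\<close> divides the resultant, the resultant has zero gradient at a point of
  \<open>f = 0\<close>; hence the gradient of the quadric is a multiple of the gradient of the first subresultant,
  and by \<open>torus_division\<close> so is the gradient of the torus polynomial.\<close>

lemma gradients_parallel_at_lift:
  assumes f: "f^2 dvd S0 R r q1 q0" and v: "eval2 f v = 0" "eval2 (sres1 R r q1 q0) v \<noteq> 0"
    and T': "(eval3 (torus_poly R r) has_derivative T') (at (lift R r q1 q0 v))"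
    and Q': "(eval3 (quadric_poly q1 q0) has_derivative Q') (at (lift R r q1 q0 v))"
  shows "T' h * Q' k = T' k * Q' h"
proof -
  define w where "w = lift R r q1 q0 v"
  have Pw: "Pi_z w = v" by (simp add: w_def)
  obtain g where g: "S0 R r q1 q0 = f^2 * g" using f by (elim dvdE)
  have "eval2 (S0 R r q1 q0) v = 0" using v by (simp add: g)
  hence Q0: "eval3 (quadric_poly q1 q0) w = 0"
    using lift_in_intersection[OF v(2)] by (simp add: w_def mem_intersection_iff)
  define L where "L = subresultant_at R r q1 q0"
  have L0: "L w = 0" using subresultant_vanishes_on_lift[OF v(2)] by (simp add: L_def w_def)
  define A where "A = (\<lambda>w::real^3. (w$3)^2 - eval2 q1 (Pi_z w) * w$3 + eval2 (q1^2 + p2 R r - q0) (Pi_z w))"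
  define M where "M = (\<lambda>w. L w - 2 * eval2 (sres10 R r q1 q0) (Pi_z w) + eval2 (q1 * sres1 R r q1 q0) (Pi_z w))"
  define s where "s = (\<lambda>w. eval2 (sres1 R r q1 q0) (Pi_z w))"
  define F where "F = (\<lambda>w. eval2 f (Pi_z w))"
  define G where "G = (\<lambda>w. eval2 g (Pi_z w))"
  note poly_intros = real_polynomial_function_intros real_polynomial_function_power
    real_polynomial_function_eval2_Pi_z real_polynomial_function_component
  have "real_polynomial_function L" "real_polynomial_function s" "real_polynomial_function F"
    "real_polynomial_function G" "real_polynomial_function A"
    unfolding L_def s_def F_def G_def A_def subresultant_at_def[abs_def] by (intro poly_intros)+
  moreover from this have "real_polynomial_function M" unfolding M_def by (intro poly_intros)
  ultimately obtain L' s' F' G' A' M' where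
    D: "(L has_derivative L') (at w)" "(s has_derivative s') (at w)" "(F has_derivative F') (at w)"
      "(G has_derivative G') (at w)" "(A has_derivative A') (at w)" "(M has_derivative M') (at w)"
    by (meson real_polynomial_function_has_derivative)
  note T' = T'[folded w_def] and Q' = Q'[folded w_def]
  have "eval3 (torus_poly R r) = (\<lambda>w. A w * eval3 (quadric_poly q1 q0) w - L w)"
    unfolding A_def L_def by (rule ext) (rule torus_division)
  hence "(eval3 (torus_poly R r) has_derivative
      (\<lambda>h. (A w * Q' h + A' h * eval3 (quadric_poly q1 q0) w) - L' h)) (at w)"
    using has_derivative_diff[OF has_derivative_mult[OF D(5) Q'] D(1)] by simp
  from has_derivative_unique[OF T' this] have T: "T' h = A w * Q' h - L' h" for h
    by (simp add: Q0)
  have left: "((\<lambda>w. (s w * s w) * eval3 (quadric_poly q1 q0) w) has_derivative (\<lambda>h.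
      (s w * s w) * Q' h + (s w * s' h + s' h * s w) * eval3 (quadric_poly q1 q0) w)) (at w)"
    by (intro has_derivative_mult D Q')
  have right: "((\<lambda>w. (F w * F w) * G w + L w * M w) has_derivative (\<lambda>h.
      ((F w * F w) * G' h + (F w * F' h + F' h * F w) * G w) + (L w * M' h + L' h * M w))) (at w)"
    by (intro has_derivative_add has_derivative_mult D)
  have "(s u * s u) * eval3 (quadric_poly q1 q0) u = (F u * F u) * G u + L u * M u" for u
    using quadric_elimination[of R r q1 q0 u]
    by (simp add: L_def s_def M_def F_def G_def g power2_eq_square mult.assoc)
  hence "(\<lambda>w. (s w * s w) * eval3 (quadric_poly q1 q0) w) = (\<lambda>w. (F w * F w) * G w + L w * M w)"
    by (rule ext)
  note fun_cong[OF has_derivative_unique[OF left[unfolded this] right]]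
  \<comment> \<open>The square of \<open>f\<close> enters here: both terms in the derivative of \<open>f^2 g\<close> contain \<open>F w\<close>.\<close>
  moreover have "F w = 0" using v by (simp add: F_def Pw)
  ultimately have "(s w * s w) * Q' h = L' h * M w" for h
    unfolding Q0 L0 by simp
  moreover have "s w \<noteq> 0" using v by (simp add: s_def Pw)
  ultimately have Q: "Q' h = (M w / (s w * s w)) * L' h" for h by (simp add: field_simps)
  show ?thesis unfolding T Q by (simp add: algebra_simps)
qed

section \<open>The lifted curve as a component of the intersection\<close>

text \<open>The lift is a rational map with denominator \<open>sres1\<close>, so a polynomial in space pulls back to a
  plane polynomial once the denominator is cleared. This reduces the irreducibility of the lifted
  curve to the primality of \<open>f\<close>.\<close>

lemma real_polynomial_function_on_lift:
  assumes "real_polynomial_function G"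
  shows "\<exists>n p. \<forall>v. eval2 (sres1 R r q1 q0) v \<noteq> 0 \<longrightarrow>
    eval2 (sres1 R r q1 q0) v ^ n * G (lift R r q1 q0 v) = eval2 p v"
  using assms
proof (induction G rule: real_polynomial_function.induct)
  case (linear G)
  let ?s1 = "sres1 R r q1 q0" and ?s10 = "sres10 R r q1 q0"
  let ?p = "?s1 * (cst (G (axis 1 1)) * var_x + cst (G (axis 2 1)) * var_y) - cst (G (axis 3 1)) * ?s10"
  have G: "G w = w$1 * G (axis 1 1) + w$2 * G (axis 2 1) + w$3 * G (axis 3 1)" for w
  proof -
    have w: "w = w$1 *\<^sub>R axis 1 1 + w$2 *\<^sub>R axis 2 1 + w$3 *\<^sub>R axis 3 1"
      by (rule vec3_eqI) (simp_all add: axis_def)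
    have lin: "linear G" using linear by (rule bounded_linear.linear)
    show ?thesis by (subst w) (simp add: linear_add[OF lin] linear_scale[OF lin])
  qed
  have "eval2 ?s1 v ^ 1 * G (lift R r q1 q0 v) = eval2 ?p v" if "eval2 ?s1 v \<noteq> 0" for v
    using that unfolding G[of "lift R r q1 q0 v"] lift_3
    by (simp add: lift_def field_simps)
  thus ?case by blast
next
  case (const c)
  show ?case by (intro exI[of _ 0] exI[of _ "cst c"]) simp
next
  case (add G H)
  let ?s1 = "sres1 R r q1 q0"
  obtain n p m q where
    p: "\<And>v. eval2 ?s1 v \<noteq> 0 \<Longrightarrow> eval2 ?s1 v ^ n * G (lift R r q1 q0 v) = eval2 p v" and
    q: "\<And>v. eval2 ?s1 v \<noteq> 0 \<Longrightarrow> eval2 ?s1 v ^ m * H (lift R r q1 q0 v) = eval2 q v"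
    using add.IH by blast
  have "eval2 ?s1 v ^ (n + m) * (G (lift R r q1 q0 v) + H (lift R r q1 q0 v))
      = eval2 (?s1 ^ m * p + ?s1 ^ n * q) v" if "eval2 ?s1 v \<noteq> 0" for v
    unfolding eval2_simps p[OF that, symmetric] q[OF that, symmetric]
    by (simp add: power_add algebra_simps)
  thus ?case by blast
next
  case (mult G H)
  let ?s1 = "sres1 R r q1 q0"
  obtain n p m q where
    p: "\<And>v. eval2 ?s1 v \<noteq> 0 \<Longrightarrow> eval2 ?s1 v ^ n * G (lift R r q1 q0 v) = eval2 p v" and
    q: "\<And>v. eval2 ?s1 v \<noteq> 0 \<Longrightarrow> eval2 ?s1 v ^ m * H (lift R r q1 q0 v) = eval2 q v"
    using mult.IH by blast
  have "eval2 ?s1 v ^ (n + m) * (G (lift R r q1 q0 v) * H (lift R r q1 q0 v))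
      = eval2 (p * q) v" if "eval2 ?s1 v \<noteq> 0" for v
    unfolding eval2_simps p[OF that, symmetric] q[OF that, symmetric]
    by (simp add: power_add algebra_simps)
  thus ?case by blast
qed

lemma infinite_curve_off_sres1:
  assumes "irreducible f" "infinite (curve f)" "\<not> f dvd sres1 R r q1 q0"
  shows "infinite {v \<in> curve f. eval2 (sres1 R r q1 q0) v \<noteq> 0}"
proof
  assume "finite {v \<in> curve f. eval2 (sres1 R r q1 q0) v \<noteq> 0}"
  moreover have "finite (curve f \<inter> curve (sres1 R r q1 q0))"
    using finite_common_zeros assms(1,3) by blast
  ultimately have "finite ({v \<in> curve f. eval2 (sres1 R r q1 q0) v \<noteq> 0}
      \<union> (curve f \<inter> curve (sres1 R r q1 q0)))" by (rule finite_UnI)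
  moreover have "curve f \<subseteq> {v \<in> curve f. eval2 (sres1 R r q1 q0) v \<noteq> 0}
      \<union> (curve f \<inter> curve (sres1 R r q1 q0))" by (auto simp: curve_def)
  ultimately show False using assms(2) finite_subset by blast
qed

lemma zariski_irreducible_lifted_curve:
  assumes f: "irreducible f" and inf: "infinite (curve f)" and nd: "\<not> f dvd sres1 R r q1 q0"
  shows "zariski_irreducible
    (zariski_closure (lift R r q1 q0 ` {v \<in> curve f. eval2 (sres1 R r q1 q0) v \<noteq> 0}))"
proof (rule zariski_irreducible_closureI)
  let ?s1 = "sres1 R r q1 q0" and ?lift = "lift R r q1 q0"
  let ?C = "{v \<in> curve f. eval2 ?s1 v \<noteq> 0}"
  have infC: "infinite ?C" by (rule infinite_curve_off_sres1[OF assms])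
  hence "?C \<noteq> {}" by (rule infinite_imp_nonempty)
  thus "?lift ` ?C \<noteq> {}" by (simp only: image_is_empty not_False_eq_True)
  fix G H :: "real^3 \<Rightarrow> real"
  assume G: "real_polynomial_function G" and H: "real_polynomial_function H"
    and GH: "\<forall>w\<in>?lift ` ?C. G w * H w = 0"
  obtain n p where p: "\<And>v. eval2 ?s1 v \<noteq> 0 \<Longrightarrow> eval2 ?s1 v ^ n * G (?lift v) = eval2 p v"
    using real_polynomial_function_on_lift[OF G] by blast
  obtain m q where q: "\<And>v. eval2 ?s1 v \<noteq> 0 \<Longrightarrow> eval2 ?s1 v ^ m * H (?lift v) = eval2 q v"
    using real_polynomial_function_on_lift[OF H] by blast
  have "eval2 (p * q) v = 0" if "v \<in> ?C" for v
  proof -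
    have "eval2 (p * q) v = eval2 ?s1 v ^ n * eval2 ?s1 v ^ m * (G (?lift v) * H (?lift v))"
    proof -
      have nz: "eval2 ?s1 v \<noteq> 0" using that by simp
      show ?thesis unfolding eval2_simps p[OF nz, symmetric] q[OF nz, symmetric]
        by (simp only: ac_simps)
    qed
    thus ?thesis using GH that by simp
  qed
  hence "?C \<subseteq> curve f \<inter> curve (p * q)" by (auto simp: curve_def)
  hence "f dvd p * q"
    using dvd_if_vanishing_on_infinite[OF f] infC finite_subset by blast
  hence "f dvd p \<or> f dvd q"
    using irreducible_imp_prime_elem[OF f] by (simp add: prime_elem_dvd_mult_iff)
  moreover have "\<forall>w\<in>?lift ` ?C. G w = 0" if "f dvd p"
  proof -
    have "eval2 p v = 0" if "v \<in> ?C" for v using that \<open>f dvd p\<close> by (auto simp: curve_def elim: dvdE)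
    thus ?thesis using p by fastforce
  qed
  moreover have "\<forall>w\<in>?lift ` ?C. H w = 0" if "f dvd q"
  proof -
    have "eval2 q v = 0" if "v \<in> ?C" for v using that \<open>f dvd q\<close> by (auto simp: curve_def elim: dvdE)
    thus ?thesis using q by fastforce
  qed
  ultimately show "(\<forall>w\<in>?lift ` ?C. G w = 0) \<or> (\<forall>w\<in>?lift ` ?C. H w = 0)" by blast
qed

text \<open>The two equations say that over \<open>v\<close> the quadric divides the torus polynomial:
  \<open>z^4 + p2 z^2 + p0 = (z^2 + q1 z + q0) (z^2 - q1 z + q0)\<close>. Substituting \<open>q0 = (q1^2 + p2) / 2\<close> into
  \<open>4 q0^2 = 4 p0 = p2^2 - 16 R^2 (x^2 + y^2)\<close> gives a vanishing sum of three nonnegative terms, because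
  \<open>p2 > 0\<close> for a ring torus. This is what rules out that a whole cylinder over a real curve cuts both
  surfaces in two common sheets.\<close>

lemma common_quadratic_factor_only_over_origin:
  assumes R: "0 < r" "r < R"
    and W: "eval2 (q1^2 + p2 R r - 2*q0) v = 0"
    and N: "eval2 (p0 R r - q0^2) v = 0"
  shows "v = 0"
proof -
  define x y where "x = v$1" and "y = v$2"
  define P where "P = 2 * (R^2 - r^2 + x^2 + y^2)"
  define s t where "s = eval2 q1 v" and "t = eval2 q0 v"
  have R2: "r^2 < R^2" using R by (intro power_strict_mono) auto
  have P: "P > 0" unfolding P_def using R2 by (smt (verit) zero_le_power2)
  have t: "t = (s^2 + P) / 2"
    using W by (simp add: p2_def P_def s_def t_def x_def y_def)
  have "(R^2 + 2*R*r + r^2 - x^2 - y^2) * (R^2 - 2*R*r + r^2 - x^2 - y^2) = t^2"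
    using N by (simp add: p0_def t_def x_def y_def)
  moreover have "4 * ((R^2 + 2*R*r + r^2 - x^2 - y^2) * (R^2 - 2*R*r + r^2 - x^2 - y^2))
      = P^2 - 16 * R^2 * (x^2 + y^2)"
    by (simp add: P_def power2_eq_square algebra_simps)
  ultimately have "4 * t^2 = P^2 - 16 * R^2 * (x^2 + y^2)" by simp
  moreover have "4 * t^2 = (s^2 + P)^2" unfolding t by (simp add: power2_eq_square)
  ultimately have "(s^2)^2 + 2 * s^2 * P + 16 * R^2 * (x^2 + y^2) = 0"
    by (simp add: power2_eq_square algebra_simps)
  moreover have "0 \<le> (s^2)^2" "0 \<le> 2 * s^2 * P" "0 \<le> 16 * R^2 * (x^2 + y^2)" using P by simp_all
  ultimately have "16 * R^2 * (x^2 + y^2) = 0" by linarith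
  hence "x^2 + y^2 = 0" using R by simp
  thus ?thesis by (intro vec2_eqI) (auto simp: x_def y_def sum_power2_eq_zero_iff)
qed

lemma p0_minus_square_via_subresultants:
  "p0 R r - q0^2 = q0 * (q1^2 + p2 R r - 2*q0) - sres10 R r q1 q0"
  by (simp add: sres10_explicit power2_eq_square algebra_simps)

text \<open>An irreducible common factor of \<open>sres1\<close> and the resultant that does not divide \<open>q1\<close> would make the quadric a
  divisor of the torus polynomial along all of the curve \<open>f = 0\<close>, hence confine the curve to the origin.\<close>

lemma not_dvd_sres1:
  assumes R: "0 < r" "r < R" and f: "irreducible f" and S: "f dvd S0 R r q1 q0"
    and inf: "infinite (curve f)" and nd: "\<not> f dvd q1"
  shows "\<not> f dvd sres1 R r q1 q0"
proof
  let ?W = "q1^2 + p2 R r - 2*q0"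
  assume "f dvd sres1 R r q1 q0"
  hence W: "f dvd ?W"
    using nd irreducible_imp_prime_elem[OF f] by (simp add: sres1_explicit prime_elem_dvd_mult_iff)
  have "f dvd S0 R r q1 q0 - q1^2 * ?W * (p0 R r - q0^2)"
    using S W by (intro dvd_diff) simp_all
  also have "\<dots> = (sres10 R r q1 q0)^2" by (simp add: S0_explicit sres10_explicit)
  finally have "f dvd sres10 R r q1 q0"
    using irreducible_imp_prime_elem[OF f] prime_elem_dvd_power by blast
  hence N: "f dvd p0 R r - q0^2"
    unfolding p0_minus_square_via_subresultants[of R r q0 q1] using W by (intro dvd_diff) simp_all
  have "curve f \<subseteq> {0}"
  proof
    fix v assume "v \<in> curve f"
    hence "eval2 ?W v = 0" "eval2 (p0 R r - q0^2) v = 0"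
      using W N by (auto simp: curve_def elim!: dvdE simp del: eval2_simps(7,8))
    thus "v \<in> {0}" using common_quadratic_factor_only_over_origin[OF R] by blast
  qed
  thus False using inf finite_subset by blast
qed

text \<open>A vanishing resultant yields a common factor; the quadric being irreducible, it would divide the
  torus polynomial over every point of the plane.\<close>

lemma S0_nonzero:
  assumes R: "0 < r" "r < R" and irr: "irreducible (quadric_poly q1 q0)" and q1: "q1 \<noteq> 0"
  shows "S0 R r q1 q0 \<noteq> 0"
proof
  let ?T = "torus_poly R r" and ?Q = "quadric_poly q1 q0" and ?W = "q1^2 + p2 R r - 2*q0"
  assume "S0 R r q1 q0 = 0"
  hence deg: "degree (gcd ?T ?Q) \<noteq> 0" by (simp add: S0_def resultant_0_gcd)
  have "\<not> is_unit (gcd ?T ?Q)"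
  proof
    assume "is_unit (gcd ?T ?Q)"
    then obtain c where "gcd ?T ?Q = [:c:]" by (rule is_unit_polyE)
    hence "degree (gcd ?T ?Q) = degree [:c:]" by (rule arg_cong)
    thus False using deg by simp
  qed
  \<comment> \<open>The common factor is not a unit and divides the irreducible quadric, so it is associated to it.\<close>
  hence "?Q dvd gcd ?T ?Q" using irreducibleD'[OF irr, of "gcd ?T ?Q"] by blast
  hence "?Q dvd ?T" by simp
  hence "?Q dvd ?T + - [:q1^2 + p2 R r - q0, - q1, 1:] * ?Q" by (intro dvd_add dvd_triv_right)
  hence dvd: "?Q dvd [:- sres10 R r q1 q0, - sres1 R r q1 q0:]"
    unfolding torus_mod_quadric sres1_explicit sres10_explicit .
  have "[:- sres10 R r q1 q0, - sres1 R r q1 q0:] = 0"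
  proof (rule ccontr)
    assume "\<not> ?thesis"
    hence "degree ?Q \<le> degree [:- sres10 R r q1 q0, - sres1 R r q1 q0:]"
      using dvd by (rule dvd_imp_degree_le[rotated])
    thus False by (simp add: quadric_poly_def split: if_splits)
  qed
  hence s: "sres1 R r q1 q0 = 0" "sres10 R r q1 q0 = 0" by simp_all
  hence W: "?W = 0" using q1 by (simp add: sres1_explicit)
  have "p0 R r - q0^2 = 0"
    unfolding p0_minus_square_via_subresultants[of R r q0 q1] W s by simp
  \<comment> \<open>Any point other than the origin would do.\<close>
  hence "(vector [1, 0] :: real^2) = 0"
    using common_quadratic_factor_only_over_origin[OF R, of q1 q0 "vector [1, 0]"] W by simp
  hence "(vector [1, 0] :: real^2) $ 1 = 0" by simp
  thus False by simp
qed

text \<open>For maximality, let \<open>Z\<close> be an irreducible subset of the intersection that contains \<open>K\<close>. The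
  resultant vanishes on \<open>Z\<close>, so \<open>Z\<close> lies over \<open>f = 0\<close> or over the cofactor \<open>g\<close> of the full power of
  \<open>f\<close>; the latter is impossible since \<open>f\<close> and \<open>g\<close> have only finitely many common zeros. Over
  \<open>f = 0\<close> the only points of the intersection outside the lifted curve are those over the finitely
  many zeros of \<open>sres1\<close> on \<open>f = 0\<close>, at most two over each. So \<open>Z\<close> is covered by \<open>K\<close> and a finite set.\<close>

lemma lifted_curve_is_component:
  fixes R r q1 q0 f
  defines "C \<equiv> {v \<in> curve f. eval2 (sres1 R r q1 q0) v \<noteq> 0}"
  defines "K \<equiv> zariski_closure (lift R r q1 q0 ` C)"
  assumes S: "S0 R r q1 q0 \<noteq> 0" and f: "irreducible f" and fS: "f dvd S0 R r q1 q0"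
    and inf: "infinite (curve f)" and nd: "\<not> f dvd sres1 R r q1 q0"
  shows "irreducible_component K (intersection R r q1 q0)"
    and "Pi_z ` K \<subseteq> curve f"
    and "{w \<in> K. eval2 (sres1 R r q1 q0) (Pi_z w) \<noteq> 0} = lift R r q1 q0 ` C"
proof -
  let ?I = "intersection R r q1 q0" and ?s1 = "sres1 R r q1 q0" and ?lift = "lift R r q1 q0"
  have S0C: "eval2 (S0 R r q1 q0) v = 0" if "eval2 f v = 0" for v
    using fS that by (auto elim!: dvdE)
  have closed_I: "zariski_closed ?I"
    unfolding intersection_def surface_def
    by (intro zariski_closed_Int zariski_closed_zeros real_polynomial_function_eval3)
  have closed_cyl: "zariski_closed {w. eval2 g (Pi_z w) = 0}" for g
    by (intro zariski_closed_zeros real_polynomial_function_eval2_Pi_z)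
  have K_closed: "zariski_closed K" unfolding K_def by (rule zariski_closed_closure)
  have lift_K: "?lift ` C \<subseteq> K" unfolding K_def by (rule subset_zariski_closure)
  have K_I: "K \<subseteq> ?I" unfolding K_def
    using S0C by (intro zariski_closure_minimal closed_I)
      (auto simp: C_def curve_def intro!: lift_in_intersection)
  have K_cyl: "K \<subseteq> {w. eval2 f (Pi_z w) = 0}" unfolding K_def
    by (intro zariski_closure_minimal closed_cyl) (auto simp: C_def curve_def)
  thus "Pi_z ` K \<subseteq> curve f" by (auto simp: curve_def)
  have on_lift: "w \<in> ?lift ` C"
    if "w \<in> ?I" "eval2 f (Pi_z w) = 0" "eval2 ?s1 (Pi_z w) \<noteq> 0" for w
    using eq_lift_if_subresultant_vanishes[OF subresultant_vanishes_on_intersection that(3)] that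
    by (auto simp: C_def curve_def)
  show "{w \<in> K. eval2 ?s1 (Pi_z w) \<noteq> 0} = ?lift ` C"
  proof
    show "{w \<in> K. eval2 ?s1 (Pi_z w) \<noteq> 0} \<subseteq> ?lift ` C" using K_I K_cyl on_lift by blast
    show "?lift ` C \<subseteq> {w \<in> K. eval2 ?s1 (Pi_z w) \<noteq> 0}" using lift_K by (auto simp: C_def)
  qed
  have infC: "infinite C" unfolding C_def by (rule infinite_curve_off_sres1[OF f inf nd])
  have infK: "infinite K"
  proof
    assume "finite K"
    hence "finite (Pi_z ` ?lift ` C)" using lift_K finite_subset by blast
    moreover have "Pi_z ` ?lift ` C = C" by (force simp: image_image)
    ultimately show False using infC by simp
  qed
  have irrK: "zariski_irreducible K" unfolding K_def C_def
    by (rule zariski_irreducible_lifted_curve[OF f inf nd])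
  show "irreducible_component K ?I" unfolding irreducible_component_def
  proof (intro conjI allI impI irrK K_I)
    fix Z assume Z: "zariski_irreducible Z \<and> K \<subseteq> Z \<and> Z \<subseteq> ?I"
    obtain g where g: "S0 R r q1 q0 = f ^ multiplicity f (S0 R r q1 q0) * g" "\<not> f dvd g"
      using multiplicity_decompose'[OF S irreducible_not_unit[OF f]] .
    have "Z \<subseteq> {w. eval2 f (Pi_z w) = 0} \<union> {w. eval2 g (Pi_z w) = 0}"
    proof
      fix w assume "w \<in> Z"
      hence "eval2 (S0 R r q1 q0) (Pi_z w) = 0"
        using Z resultant_vanishes_on_intersection by blast
      hence "eval2 f (Pi_z w) ^ multiplicity f (S0 R r q1 q0) * eval2 g (Pi_z w) = 0"
        by (subst (asm) g(1)) simp
      thus "w \<in> {w. eval2 f (Pi_z w) = 0} \<union> {w. eval2 g (Pi_z w) = 0}" by auto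
    qed
    moreover have "\<not> Z \<subseteq> {w. eval2 g (Pi_z w) = 0}"
    proof
      assume "Z \<subseteq> {w. eval2 g (Pi_z w) = 0}"
      hence "?lift ` C \<subseteq> {w. eval2 g (Pi_z w) = 0}" using lift_K Z by blast
      hence "C \<subseteq> curve f \<inter> curve g" by (force simp: C_def curve_def)
      thus False using finite_common_zeros[OF f g(2)] infC finite_subset by blast
    qed
    ultimately have Zf: "Z \<subseteq> {w. eval2 f (Pi_z w) = 0}"
      using zariski_irreducible_subset_cases[OF conjunct1[OF Z] closed_cyl closed_cyl] by blast
    let ?F = "\<Union>v\<in>curve f \<inter> curve ?s1. {w \<in> ?I. Pi_z w = v}"
    have finF: "finite ?F"
      by (intro finite_UN_I finite_common_zeros[OF f nd] finite_intersection_fibre)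
    have "Z \<subseteq> K \<union> ?F"
    proof
      fix w assume w: "w \<in> Z"
      show "w \<in> K \<union> ?F"
      proof (cases "eval2 ?s1 (Pi_z w) = 0")
        case True
        thus ?thesis using w Z Zf by (auto simp: curve_def)
      next
        case False
        moreover have "w \<in> ?I" using w Z by blast
        moreover have "eval2 f (Pi_z w) = 0" using w Zf by blast
        ultimately have "w \<in> ?lift ` C" by (intro on_lift)
        thus ?thesis using lift_K by blast
      qed
    qed
    hence "Z \<subseteq> K \<or> Z \<subseteq> ?F"
      by (intro zariski_irreducible_subset_cases[OF conjunct1[OF Z] K_closed zariski_closed_finite[OF finF]])
    moreover have "\<not> Z \<subseteq> ?F" using finF infK Z by (meson finite_subset order.trans)
    ultimately show "Z = K" using Z by blast
  qed
qed

text \<open>Where \<open>sres1\<close> vanishes the lift is undefined, but proportionality of the gradients extends to the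
  Zariski closure, and the gradient of the torus polynomial vanishes nowhere on the torus.\<close>

lemma tangential_on_lifted_curve:
  assumes R: "0 < r" "r < R" and f: "f^2 dvd S0 R r q1 q0"
    and w: "w \<in> zariski_closure
      (lift R r q1 q0 ` {v \<in> curve f. eval2 (sres1 R r q1 q0) v \<noteq> 0})"
    and T: "eval3 (torus_poly R r) w = 0"
  shows "tangential_at R r q1 q0 w"
proof -
  obtain T' where T': "\<And>w. (eval3 (torus_poly R r) has_derivative T' w) (at w)"
      "\<And>h. real_polynomial_function (\<lambda>w. T' w h)"
    using real_polynomial_function_has_derivative[OF real_polynomial_function_eval3] by meson
  obtain Q' where Q': "\<And>w. (eval3 (quadric_poly q1 q0) has_derivative Q' w) (at w)"
      "\<And>h. real_polynomial_function (\<lambda>w. Q' w h)"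
    using real_polynomial_function_has_derivative[OF real_polynomial_function_eval3] by meson
  have "T' w h * Q' w k = T' w k * Q' w h" for h k
  proof -
    have "real_polynomial_function (\<lambda>w. T' w h * Q' w k - T' w k * Q' w h)"
      by (intro real_polynomial_function_intros T'(2) Q'(2))
    moreover have "T' u h * Q' u k - T' u k * Q' u h = 0"
      if "u \<in> lift R r q1 q0 ` {v \<in> curve f. eval2 (sres1 R r q1 q0) v \<noteq> 0}" for u
      using gradients_parallel_at_lift[OF f _ _ T'(1) Q'(1)] that by (auto simp: curve_def)
    ultimately have "T' w h * Q' w k - T' w k * Q' w h = 0"
      by (rule w[unfolded mem_zariski_closure_iff, rule_format])
    thus ?thesis by simp
  qed
  moreover obtain h0 where "T' w h0 \<noteq> 0" using gradient_torus_nonzero[OF R T T'(1)] by blast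
  ultimately show ?thesis
    unfolding tangential_at_def by (intro rank_jacobian_pair_eq_1[OF T'(1) Q'(1)])
qed

section \<open>Meridian circles\<close>

lemma mem_sphere_3:
  fixes c w :: "real^3"
  assumes "0 \<le> r"
  shows "w \<in> sphere c r \<longleftrightarrow> (w$1 - c$1)^2 + (w$2 - c$2)^2 + (w$3 - c$3)^2 = r^2"
proof -
  have "(dist c w)^2 = (w$1 - c$1)^2 + (w$2 - c$2)^2 + (w$3 - c$3)^2"
    unfolding dist_norm power2_norm_eq_inner
    by (simp add: inner_vec_def sum_3 power2_eq_square algebra_simps)
  moreover have "w \<in> sphere c r \<longleftrightarrow> (dist c w)^2 = r^2"
    using assms by (simp add: power2_eq_iff_nonneg)
  ultimately show ?thesis by simp
qed

lemma collinear_with_unit_vector: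
  fixes m v :: "real^2"
  assumes m: "(m$1)^2 + (m$2)^2 = 1" and col: "m$1 * v$2 = m$2 * v$1"
  shows "v = (m$1 * v$1 + m$2 * v$2) *\<^sub>R m"
proof (rule vec2_eqI)
  have "(m$1 * v$1 + m$2 * v$2) * m$1 = ((m$1)^2 + (m$2)^2) * v$1"
    using col by (simp add: power2_eq_square algebra_simps)
  thus "v$1 = ((m$1 * v$1 + m$2 * v$2) *\<^sub>R m) $ 1" by (simp add: m)
  have "(m$1 * v$1 + m$2 * v$2) * m$2 = m$1 * (m$2 * v$1) + (m$2)^2 * v$2"
    by (simp add: power2_eq_square algebra_simps)
  also have "\<dots> = ((m$1)^2 + (m$2)^2) * v$2"
    unfolding col[symmetric] by (simp add: power2_eq_square algebra_simps)
  finally show "v$2 = ((m$1 * v$1 + m$2 * v$2) *\<^sub>R m) $ 2" by (simp add: m)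
qed

definition vertical_plane :: "real^2 \<Rightarrow> (real^3) set" where
  "vertical_plane m = {w. vector [- m$2, m$1, 0] \<bullet> w = 0}"

text \<open>On such a plane the signed distance \<open>t\<close> to the axis and the height \<open>z\<close> serve as coordinates.\<close>

lemma mem_vertical_plane_iff:
  assumes m: "(m$1)^2 + (m$2)^2 = 1"
  shows "w \<in> vertical_plane m \<longleftrightarrow> (\<exists>t. Pi_z w = t *\<^sub>R m)"
proof
  assume "w \<in> vertical_plane m"
  hence *: "m$1 * w$2 = m$2 * w$1" by (simp add: vertical_plane_def inner_vec_def sum_3)
  hence "Pi_z w = (m$1 * Pi_z w$1 + m$2 * Pi_z w$2) *\<^sub>R m"
    by (intro collinear_with_unit_vector m) (simp add: Pi_z_def)
  thus "\<exists>t. Pi_z w = t *\<^sub>R m" ..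
next
  assume "\<exists>t. Pi_z w = t *\<^sub>R m"
  then obtain t where "Pi_z w = t *\<^sub>R m" ..
  hence "Pi_z w $ 1 = t * m$1" "Pi_z w $ 2 = t * m$2" by simp_all
  thus "w \<in> vertical_plane m" by (simp add: vertical_plane_def inner_vec_def sum_3 Pi_z_def)
qed

text \<open>The meridian circle on the side of the axis to which the unit vector \<open>m\<close> points.\<close>

definition meridian :: "real \<Rightarrow> real \<Rightarrow> real^2 \<Rightarrow> (real^3) set" where
  "meridian R r m = sphere (vector [R * m$1, R * m$2, 0]) r \<inter> vertical_plane m"

lemma mem_sphere_in_vertical_plane:
  assumes m: "(m$1)^2 + (m$2)^2 = 1" and r: "0 \<le> r" and w: "Pi_z w = t *\<^sub>R m"
  shows "w \<in> sphere (vector [s * m$1, s * m$2, 0]) r \<longleftrightarrow> (t - s)^2 + (w$3)^2 = r^2"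
proof -
  have "Pi_z w $ 1 = t * m$1" "Pi_z w $ 2 = t * m$2" using w by simp_all
  hence w12: "w$1 = t * m$1" "w$2 = t * m$2" by (simp_all add: Pi_z_def)
  have "(t * m$1 - s * m$1)^2 + (t * m$2 - s * m$2)^2 = (t - s)^2 * ((m$1)^2 + (m$2)^2)"
    by (simp add: power2_eq_square algebra_simps)
  thus ?thesis using m unfolding mem_sphere_3[OF r] by (simp add: w12)
qed

lemma torus_on_vertical_plane:
  assumes m: "(m$1)^2 + (m$2)^2 = 1" and w: "Pi_z w = t *\<^sub>R m"
  shows "eval3 (torus_poly R r) w
    = ((t - R)^2 + (w$3)^2 - r^2) * ((t + R)^2 + (w$3)^2 - r^2)"
proof -
  have "Pi_z w $ 1 = t * m$1" "Pi_z w $ 2 = t * m$2" using w by simp_all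
  hence "(w$1)^2 + (w$2)^2 = t^2 * ((m$1)^2 + (m$2)^2)"
    by (simp add: Pi_z_def power_mult_distrib algebra_simps)
  hence "(w$1)^2 + (w$2)^2 = t^2" by (simp add: m)
  thus ?thesis
    by (simp add: eval3_torus_cartesian power2_eq_square algebra_simps)
qed

lemma meridian_circle_meridian:
  assumes R: "0 < r" "r < R" and m: "(m$1)^2 + (m$2)^2 = 1"
  shows "meridian_circle R r (meridian R r m)"
proof -
  let ?n = "vector [- m$2, m$1, 0] :: real^3"
  let ?c = "\<lambda>s. vector [s * m$1, s * m$2, 0] :: real^3"
  have n: "?n \<noteq> 0"
  proof
    assume "?n = 0"
    hence "?n$1 = 0" "?n$2 = 0" by (simp_all only: zero_index)
    thus False using m by simp
  qed
  have c: "?c s \<in> vertical_plane m" for s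
    by (simp add: vertical_plane_def inner_vec_def sum_3)
  have distinct: "?c R \<noteq> ?c (- R)"
  proof
    assume "?c R = ?c (- R)"
    hence "?c R $ 1 = ?c (- R) $ 1" "?c R $ 2 = ?c (- R) $ 2" by (simp_all only:)
    thus False using m R by simp
  qed
  have axis: "{v::real^3. v$1 = 0 \<and> v$2 = 0} \<subseteq> vertical_plane m"
    by (auto simp: vertical_plane_def inner_vec_def sum_3)
  have circles: "surface (torus_poly R r) \<inter> vertical_plane m
      = (sphere (?c R) r \<inter> vertical_plane m) \<union> (sphere (?c (- R)) r \<inter> vertical_plane m)"
  proof -
    have "w \<in> surface (torus_poly R r) \<longleftrightarrow> w \<in> sphere (?c R) r \<or> w \<in> sphere (?c (- R)) r"
      if w: "w \<in> vertical_plane m" for w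
    proof -
      obtain t where t: "Pi_z w = t *\<^sub>R m"
        using w unfolding mem_vertical_plane_iff[OF m] by (rule exE)
      show ?thesis using R
        unfolding surface_def mem_Collect_eq torus_on_vertical_plane[OF m t] mult_eq_0_iff
          mem_sphere_in_vertical_plane[OF m less_imp_le[OF R(1)] t] by simp
    qed
    thus ?thesis by blast
  qed
  show ?thesis
    unfolding meridian_circle_def
    using n vertical_plane_def[of m] axis c[of R] c[of "- R"] distinct circles meridian_def[of R r m]
    by (intro exI[of _ ?n] exI[of _ 0] exI[of _ "vertical_plane m"] exI[of _ "?c R"]
        exI[of _ "?c (- R)"] conjI)
qed

lemma Pi_z_meridian:
  assumes r: "0 < r" and m: "(m$1)^2 + (m$2)^2 = 1"
  shows "Pi_z ` meridian R r m = (\<lambda>t. t *\<^sub>R m) ` {R - r..R + r}"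
proof (intro equalityI subsetI)
  fix v assume "v \<in> Pi_z ` meridian R r m"
  then obtain w where w: "v = Pi_z w" "w \<in> sphere (vector [R * m$1, R * m$2, 0]) r"
      "w \<in> vertical_plane m" by (auto simp: meridian_def)
  obtain t where t: "Pi_z w = t *\<^sub>R m"
    using w(3) unfolding mem_vertical_plane_iff[OF m] by (rule exE)
  have "(t - R)^2 + (w$3)^2 = r^2"
    using w(2) mem_sphere_in_vertical_plane[OF m less_imp_le[OF r] t] by blast
  hence "(t - R)^2 \<le> r^2" by (smt (verit) zero_le_power2)
  hence "\<bar>t - R\<bar> \<le> r" using r abs_le_square_iff[of "t - R" r] by simp
  thus "v \<in> (\<lambda>t. t *\<^sub>R m) ` {R - r..R + r}" unfolding w(1) t by (intro imageI) auto
next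
  fix v assume "v \<in> (\<lambda>t. t *\<^sub>R m) ` {R - r..R + r}"
  then obtain t where t: "v = t *\<^sub>R m" "t \<in> {R - r..R + r}" by (rule imageE)
  hence "\<bar>t - R\<bar> \<le> r" by auto
  hence "(t - R)^2 \<le> r^2" using r abs_le_square_iff[of "t - R" r] by simp
  define w :: "real^3" where "w = vector [v$1, v$2, sqrt (r^2 - (t - R)^2)]"
  have Pw: "Pi_z w = v" by (rule vec2_eqI) (simp_all add: Pi_z_def w_def)
  have "(t - R)^2 + (w$3)^2 = r^2" using \<open>(t - R)^2 \<le> r^2\<close> by (simp add: w_def)
  hence "w \<in> meridian R r m"
    using mem_sphere_in_vertical_plane[OF m less_imp_le[OF r], of w t R] Pw t(1)
      mem_vertical_plane_iff[OF m, of w] by (auto simp: meridian_def)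
  thus "v \<in> Pi_z ` meridian R r m" using Pw by blast
qed

section \<open>A line carrying a double factor\<close>

text \<open>Comparison of coefficients. It is applied to the restriction of the torus equation to a line,
  where \<open>b\<close> measures the distance of the line from the origin: a quadratic polynomial whose square
  has degree two and no linear term is a multiple of \<open>t\<close>.\<close>

lemma square_equals_quadratic_coefficients:
  fixes \<alpha> \<beta> \<gamma> a b :: real
  assumes eq: "\<And>t. (\<alpha> * t^2 + \<beta> * t + \<gamma>)^2 = a * t^2 + b" and a: "a > 0"
  shows "\<alpha> = 0" "\<beta>^2 = a" "\<gamma> = 0" "b = 0"
proof -
  have even: "\<alpha>^2 * t^4 + (\<beta>^2 + 2 * \<alpha> * \<gamma>) * t^2 + \<gamma>^2 = a * t^2 + b" for t
    using eq[of t] eq[of "- t"] by (simp add: power2_eq_square power4_eq_xxxx algebra_simps)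
  have odd: "\<alpha> * \<beta> * t^3 + \<beta> * \<gamma> * t = 0" for t
    using eq[of t] eq[of "- t"] by (simp add: power2_eq_square power3_eq_cube algebra_simps)
  have "\<alpha>^2 + (\<beta>^2 + 2 * \<alpha> * \<gamma>) = a" "16 * \<alpha>^2 + 4 * (\<beta>^2 + 2 * \<alpha> * \<gamma>) = 4 * a"
    using even[of 0] even[of 1] even[of 2] by simp_all
  moreover have "\<alpha>^2 = 0" if "\<alpha>^2 + u = a" "16 * \<alpha>^2 + 4 * u = 4 * a" for u
    using that by linarith
  ultimately have "\<alpha>^2 = 0" by blast
  thus \<alpha>: "\<alpha> = 0" by simp
  show \<beta>: "\<beta>^2 = a" using even[of 0] even[of 1] \<alpha> by simp
  have "\<beta> * \<gamma> = 0" using odd[of 1] \<alpha> by simp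
  thus \<gamma>: "\<gamma> = 0" using \<beta> a by auto
  show "b = 0" using even[of 0] \<gamma> by simp
qed

text \<open>On the line \<open>q1 = 0\<close> the quadric is \<open>z^2 + q0\<close>, and \<open>sres10 = 0\<close> says that \<open>z^2 = - q0\<close> satisfies
  the torus equation \<open>(\<rho>^2 + R^2 - r^2 - q0)^2 = 4 R^2 \<rho>^2\<close>. If \<open>t\<close> is the arc length from the foot of
  the perpendicular from the origin, then \<open>\<rho>^2 = t^2 + \<delta>^2\<close>, so \<open>4 R^2 (t^2 + \<delta>^2)\<close> is the square of
  a polynomial in \<open>t\<close>, which forces \<open>\<delta> = 0\<close>. The square root \<open>\<plusminus> 2 R t\<close> then determines \<open>q0\<close> on the line
  up to the orientation of the line.\<close>

lemma line_with_vanishing_sres10: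
  fixes R r a b d e f' g h i j :: real
  assumes R: "0 < r" "r < R"
    and q1: "q1 = cst e * var_x + cst f' * var_y + cst i"
    and q0: "q0 = cst a * var_x^2 + cst b * var_y^2 + cst d * (var_x * var_y)
              + cst g * var_x + cst h * var_y + cst j"
    and line: "e \<noteq> 0 \<or> f' \<noteq> 0"
    and van: "\<And>v. eval2 q1 v = 0 \<Longrightarrow> eval2 (sres10 R r q1 q0) v = 0"
  shows "i = 0"
    and "\<exists>m. (m$1)^2 + (m$2)^2 = 1 \<and> curve q1 = range (\<lambda>t. t *\<^sub>R m)
           \<and> (\<forall>t. eval2 q0 (t *\<^sub>R m) = (t - R)^2 - r^2)"
proof -
  define N where "N = e^2 + f'^2"
  define s where "s = sqrt N"
  have N: "N > 0" unfolding N_def using line by (simp add: sum_power2_gt_zero_iff)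
  hence s: "s > 0" "s^2 = N" by (simp_all add: s_def)
  \<comment> \<open>Unit direction \<open>(d1, d2)\<close> of the line and foot \<open>(o1, o2)\<close> of the perpendicular from the origin.\<close>
  define d1 d2 where "d1 = - f' / s" and "d2 = e / s"
  define o1 o2 where "o1 = - (i * e / N)" and "o2 = - (i * f' / N)"
  have "d1^2 + d2^2 = N / s^2"
    by (simp add: d1_def d2_def power_divide N_def add_divide_distrib add.commute)
  hence unit: "d1^2 + d2^2 = 1" using s N by simp
  have perp: "o1 * d1 + o2 * d2 = 0" by (simp add: o1_def o2_def d1_def d2_def)
  have foot: "o1^2 + o2^2 = i^2 / N"
  proof -
    have "o1^2 + o2^2 = i^2 * N / N^2"
      by (simp add: o1_def o2_def power_divide power_mult_distrib N_def
          add_divide_distrib[symmetric] distrib_left)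
    thus ?thesis using N by (simp add: power2_eq_square)
  qed
  define P where "P = (\<lambda>t. vector [o1 + t * d1, o2 + t * d2] :: real^2)"
  define A where "A = a * d1^2 + b * d2^2 + d * (d1 * d2)"
  define B where "B = 2 * a * o1 * d1 + 2 * b * o2 * d2 + d * (o1 * d2 + o2 * d1) + g * d1 + h * d2"
  define C where "C = a * o1^2 + b * o2^2 + d * (o1 * o2) + g * o1 + h * o2 + j"
  have q0P: "eval2 q0 (P t) = A * t^2 + B * t + C" for t
    unfolding q0 P_def A_def B_def C_def
    by (simp add: power2_eq_square algebra_simps)
  have q1P: "eval2 q1 (P t) = 0" for t
  proof -
    have "e * o1 + f' * o2 = - i * N / N"
      unfolding N_def
      by (simp add: N_def o1_def o2_def power2_eq_square add_divide_distrib[symmetric] algebra_simps)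
    hence "e * o1 + f' * o2 = - i" using N by simp
    moreover have "e * d1 + f' * d2 = 0" by (simp add: d1_def d2_def)
    hence "t * (e * d1 + f' * d2) = 0" by simp
    ultimately show ?thesis unfolding q1 P_def by (simp add: algebra_simps)
  qed
  have rho: "(o1 + t * d1)^2 + (o2 + t * d2)^2 = t^2 + i^2 / N" for t
  proof -
    have "(o1 + t * d1)^2 + (o2 + t * d2)^2
        = t^2 * (d1^2 + d2^2) + 2 * t * (o1 * d1 + o2 * d2) + (o1^2 + o2^2)"
      by (simp add: power2_eq_square algebra_simps)
    thus ?thesis by (simp add: unit perp foot)
  qed
  have sq: "((1 - A) * t^2 + (- B) * t + (i^2 / N + R^2 - r^2 - C))^2
      = 4 * R^2 * t^2 + 4 * R^2 * (i^2 / N)" for t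
  proof -
    define x y where "x = o1 + t * d1" and "y = o2 + t * d2"
    define k where "k = eval2 q0 (P t)"
    have "2 * (R^2 - r^2 + x^2 + y^2) * k - k^2
        - (R^2 + 2*R*r + r^2 - x^2 - y^2) * (R^2 - 2*R*r + r^2 - x^2 - y^2) = 0"
      using van[OF q1P[of t]] q1P[of t]
      by (simp add: sres10_explicit p2_def p0_def k_def x_def y_def) (simp add: P_def)
    hence "((x^2 + y^2) + R^2 - r^2 - k)^2 = 4 * R^2 * (x^2 + y^2)"
      by (simp add: power2_eq_square algebra_simps)
    thus ?thesis unfolding x_def y_def rho k_def q0P by (simp add: algebra_simps)
  qed
  have R4: "4 * R^2 > 0" using R by simp
  note coeffs = square_equals_quadratic_coefficients[OF sq R4]
  have A: "A = 1" using coeffs(1) by simp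
  have B: "B^2 = 4 * R^2" using coeffs(2) by simp
  show i: "i = 0" using coeffs(4) R N by simp
  have C: "C = R^2 - r^2" using coeffs(3) i by simp
  \<comment> \<open>The sign that orients the line so that the circle has its centre at \<open>t = R\<close> rather than at \<open>t = - R\<close>.\<close>
  define \<sigma> where "\<sigma> = - B / (2 * R)"
  have \<sigma>: "\<sigma>^2 = 1" "B * \<sigma> = - 2 * R"
    using B R by (simp_all add: \<sigma>_def power_divide power_mult_distrib power2_eq_square field_simps)
  define m :: "real^2" where "m = vector [\<sigma> * d1, \<sigma> * d2]"
  have m1: "(m$1)^2 + (m$2)^2 = 1"
    using unit \<sigma>(1) by (simp add: m_def power_mult_distrib)
  have tm: "t *\<^sub>R m = P (t * \<sigma>)" for t
    by (rule vec2_eqI) (simp_all add: m_def P_def o1_def o2_def i)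
  have "eval2 q0 (t *\<^sub>R m) = (t - R)^2 - r^2" for t
  proof -
    have "eval2 q0 (t *\<^sub>R m) = t^2 * \<sigma>^2 + t * (B * \<sigma>) + (R^2 - r^2)"
      unfolding tm q0P A C by (simp add: power_mult_distrib algebra_simps)
    thus ?thesis unfolding \<sigma> by (simp add: power2_eq_square algebra_simps)
  qed
  moreover have "curve q1 = range (\<lambda>t. t *\<^sub>R m)"
  proof (intro equalityI subsetI)
    fix v assume "v \<in> curve q1"
    hence "e * v$1 + f' * v$2 = 0" by (simp add: curve_def q1 i)
    hence "(- f') * v$2 = e * v$1" by simp
    hence "(\<sigma> / s) * ((- f') * v$2) = (\<sigma> / s) * (e * v$1)" by (simp only:)
    hence "m$1 * v$2 = m$2 * v$1" by (simp add: m_def d1_def d2_def algebra_simps)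
    from collinear_with_unit_vector[OF m1 this] show "v \<in> range (\<lambda>t. t *\<^sub>R m)" by blast
  next
    fix v assume "v \<in> range (\<lambda>t. t *\<^sub>R m)"
    thus "v \<in> curve q1" using q1P by (auto simp: tm curve_def)
  qed
  ultimately show "\<exists>m. (m$1)^2 + (m$2)^2 = 1 \<and> curve q1 = range (\<lambda>t. t *\<^sub>R m)
           \<and> (\<forall>t. eval2 q0 (t *\<^sub>R m) = (t - R)^2 - r^2)" using m1 by blast
qed

lemma meridian_over_line:
  assumes R: "0 < r" "r < R" and m: "(m$1)^2 + (m$2)^2 = 1"
    and q1: "curve q1 = range (\<lambda>t. t *\<^sub>R m)"
    and q0: "\<And>t. eval2 q0 (t *\<^sub>R m) = (t - R)^2 - r^2"
  shows "curve q1 \<inter> region R r q1 q0 = Pi_z ` meridian R r m"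
    and "meridian R r m \<subseteq> intersection R r q1 q0"
proof -
  have "t *\<^sub>R m \<in> region R r q1 q0 \<longleftrightarrow> t \<in> {R - r..R + r}" for t
  proof -
    have "eval2 q1 (t *\<^sub>R m) = 0" using q1 by (auto simp: curve_def)
    hence Q: "eval2 (q1^2 - 4 * q0) (t *\<^sub>R m) = 4 * (r^2 - (t - R)^2)" by (simp add: q0)
    have rho: "(t * m$1)^2 + (t * m$2)^2 = t^2"
      using m by (simp add: power_mult_distrib flip: distrib_left)
    have "eval2 (p0 R r) (t *\<^sub>R m)
        = ((R + r)^2 - ((t * m$1)^2 + (t * m$2)^2)) * ((R - r)^2 - ((t * m$1)^2 + (t * m$2)^2))"
      by (simp add: p0_def power2_eq_square algebra_simps)
    hence T: "eval2 (p0 R r) (t *\<^sub>R m) = ((R + r)^2 - t^2) * ((R - r)^2 - t^2)" unfolding rho .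
    have "0 \<le> 4 * (r^2 - (t - R)^2) \<longleftrightarrow> \<bar>t - R\<bar> \<le> r"
      using R abs_le_square_iff[of "t - R" r] by simp
    also have "\<dots> \<longleftrightarrow> t \<in> {R - r..R + r}" by auto
    finally have disc: "0 \<le> 4 * (r^2 - (t - R)^2) \<longleftrightarrow> t \<in> {R - r..R + r}" .
    moreover have "((R + r)^2 - t^2) * ((R - r)^2 - t^2) \<le> 0" if "t \<in> {R - r..R + r}"
    proof -
      have "(R - r)^2 \<le> t^2" "t^2 \<le> (R + r)^2" using that R by (auto intro!: power_mono)
      thus ?thesis by (intro mult_nonneg_nonpos) simp_all
    qed
    ultimately show ?thesis unfolding region_def mem_Collect_eq T Q by blast
  qed
  thus "curve q1 \<inter> region R r q1 q0 = Pi_z ` meridian R r m"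
    unfolding q1 Pi_z_meridian[OF R(1) m] by blast
  show "meridian R r m \<subseteq> intersection R r q1 q0"
  proof
    fix w assume w: "w \<in> meridian R r m"
    then obtain t where t: "Pi_z w = t *\<^sub>R m"
      using mem_vertical_plane_iff[OF m, of w] by (auto simp: meridian_def)
    have circle: "(t - R)^2 + (w$3)^2 = r^2"
      using w mem_sphere_in_vertical_plane[OF m less_imp_le[OF R(1)] t, of R]
      by (simp add: meridian_def)
    have "eval3 (torus_poly R r) w = 0"
      unfolding torus_on_vertical_plane[OF m t] using circle by simp
    moreover have "eval2 q1 (t *\<^sub>R m) = 0" using q1 by (auto simp: curve_def)
    hence "eval3 (quadric_poly q1 q0) w = 0"
      unfolding eval3_quadric_poly t q0 using circle by simp
    ultimately show "w \<in> intersection R r q1 q0" by (simp add: mem_intersection_iff)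
  qed
qed

lemma segment_of_multiples:
  fixes m :: "real^2"
  assumes "a \<le> b"
  shows "(\<lambda>t. t *\<^sub>R m) ` {a..b} = closed_segment (a *\<^sub>R m) (b *\<^sub>R m)"
proof -
  have "linear (\<lambda>t::real. t *\<^sub>R m)" by (intro linearI) (simp_all add: scaleR_left_distrib)
  from closed_segment_linear_image[OF this, of a b] show ?thesis
    using assms by (simp add: closed_segment_eq_real_ivl)
qed

text \<open>Total degree is additive, so a non-constant factor of a polynomial of degree one is associated to
  it. In the representation by nested univariate polynomials this becomes a case distinction on the
  degree in \<open>y\<close>.\<close>

lemma factor_of_linear_polynomial:
  assumes f: "irreducible f" and q1: "q1 = cst e * var_x + cst f' * var_y + cst i" "q1 \<noteq> 0"
    and dvd: "f dvd q1"
  shows "\<exists>k. f = cst k * q1"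
proof -
  have q1_coeffs: "q1 = [:[:i, e:], [:f':]:]"
    unfolding q1(1) by (simp add: cst_def var_x_def var_y_def)
  obtain u where u: "q1 = f * u" using dvd by (elim dvdE)
  have nz: "f \<noteq> 0" "u \<noteq> 0" using u q1(2) by auto
  have deg: "degree q1 = degree f + degree u" unfolding u by (rule degree_mult_eq[OF nz])
  have "\<exists>c. u = cst c"
  proof (cases "degree f = 0")
    case True
    then obtain F where F: "f = [:F:]" by (rule degree_eq_zeroE)
    have "\<not> is_unit F" using irreducible_not_unit[OF f] by (simp add: F is_unit_const_poly_iff)
    hence F_deg: "degree F > 0" using nz(1) by (auto simp: F is_unit_iff_degree)
    have coeffs: "coeff q1 n = F * coeff u n" for n by (simp add: u F)
    have f'0: "f' = 0"
    proof (rule ccontr)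
      assume "f' \<noteq> 0"
      hence "is_unit (coeff q1 1)" by (simp add: q1_coeffs is_unit_const_poly_iff)
      hence "is_unit F" unfolding coeffs by (rule dvd_mult_left)
      thus False using \<open>\<not> is_unit F\<close> by simp
    qed
    hence "degree u = 0" using deg by (simp add: q1_coeffs)
    then obtain G where G: "u = [:G:]" by (rule degree_eq_zeroE)
    have "F \<noteq> 0" "G \<noteq> 0" using nz by (auto simp: F G)
    moreover have "[:i, e:] = F * G" using coeffs[of 0] by (simp add: q1_coeffs G)
    ultimately have "degree F + degree G = degree [:i, e:]" by (simp add: degree_mult_eq)
    also have "\<dots> \<le> 1" by simp
    finally have "degree G = 0" using F_deg by simp
    thus ?thesis unfolding G cst_def by (metis degree_eq_zeroE)
  next
    case False
    have "degree q1 \<le> 1" by (simp add: q1_coeffs)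
    hence du: "degree u = 0" and df: "degree f = 1" and dq: "degree q1 = 1"
      using False deg by simp_all
    obtain G where G: "u = [:G:]" using du by (rule degree_eq_zeroE)
    have f': "[:f':] = coeff f 1 * G"
      using arg_cong[OF u, of "\<lambda>p. coeff p 1"] by (simp add: q1_coeffs G mult.commute)
    have "f' \<noteq> 0" using dq by (auto simp: q1_coeffs)
    hence "is_unit (coeff f 1 * G)" unfolding f'[symmetric] by (simp add: is_unit_const_poly_iff)
    hence "is_unit G" by (rule dvd_mult_right)
    thus ?thesis unfolding G cst_def by (metis is_unit_polyE)
  qed
  then obtain c where c: "u = cst c" ..
  have "c \<noteq> 0" using nz(2) by (auto simp: c cst_def)
  hence "cst (1 / c) * q1 = f" unfolding u c by (simp add: cst_def)
  thus ?thesis by metis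
qed

section \<open>Multiple factors of the resultant\<close>

theorem proposition3p15:
  fixes R r a b d e f' g h i j :: real
    and q1 q0 f :: "real poly poly"
  assumes "0 < r" and "r < R"
    and "q1 = cst e * var_x + cst f' * var_y + cst i"
    and "q0 = cst a * var_x^2 + cst b * var_y^2 + cst d * (var_x * var_y)
              + cst g * var_x + cst h * var_y + cst j"
    and "irreducible (quadric_poly q1 q0)"
    and "q1 \<noteq> 0"
    and "irreducible f"
    and "f^2 dvd S0 R r q1 q0"
    and "has_dimension (curve f \<inter> cutcurve R r q1 q0) 1"
  shows
    "((\<exists>k. f = cst k * q1) \<longrightarrow>
        eval2 q1 0 = 0 \<and>
        (\<exists>u v M. u \<noteq> v \<and> curve q1 \<inter> region R r q1 q0 = closed_segment u v \<and>
           meridian_circle R r M \<and> M \<subseteq> intersection R r q1 q0 \<and>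
           Pi_z ` M = curve q1 \<inter> region R r q1 q0)) \<and>
     (\<not> (\<exists>k. f = cst k * q1) \<longrightarrow>
        finite {v \<in> curve f. eval2 (sres1 R r q1 q0) v = 0} \<and>
        (\<exists>K. irreducible_component K (intersection R r q1 q0) \<and>
           Pi_z ` K \<subseteq> curve f \<and>
           {w \<in> K. eval2 (sres1 R r q1 q0) (Pi_z w) \<noteq> 0}
             = lift R r q1 q0 ` {v \<in> curve f. eval2 (sres1 R r q1 q0) v \<noteq> 0} \<and>
           (\<forall>w\<in>K. tangential_at R r q1 q0 w)))"
proof (intro conjI impI)
  have R: "0 < r" "r < R" by fact+
  have fS: "f dvd S0 R r q1 q0"
    using assms(8) by (rule dvd_trans[rotated]) (simp add: power2_eq_square)
  {
    assume "\<exists>k. f = cst k * q1"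
    then obtain k where k: "f = cst k * q1" ..
    have line: "e \<noteq> 0 \<or> f' \<noteq> 0"
    proof (rule ccontr)
      assume "\<not> ?thesis"
      hence "f = [:[:k * i:]:]" using k assms(3) by (simp add: cst_def)
      moreover from this have "k * i \<noteq> 0" using assms(7) by auto
      ultimately have "is_unit f" by (simp add: is_unit_const_poly_iff)
      thus False using irreducible_not_unit[OF assms(7)] by simp
    qed
    have "eval2 (sres10 R r q1 q0) v = 0" if "eval2 q1 v = 0" for v
    proof -
      have "eval2 (S0 R r q1 q0) v = 0" using fS that k by (auto elim!: dvdE)
      thus ?thesis using that by (simp add: S0_via_subresultant sres1_explicit)
    qed
    note meridian = line_with_vanishing_sres10[OF R assms(3,4) line this]
    show "eval2 q1 0 = 0" using meridian(1) by (simp add: assms(3))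
    obtain m where m: "(m$1)^2 + (m$2)^2 = 1" and q1: "curve q1 = range (\<lambda>t. t *\<^sub>R m)"
      and q0: "\<And>t. eval2 q0 (t *\<^sub>R m) = (t - R)^2 - r^2"
      using meridian(2) by blast
    note M = meridian_over_line[OF R m q1 q0]
    show "\<exists>u v M. u \<noteq> v \<and> curve q1 \<inter> region R r q1 q0 = closed_segment u v \<and>
        meridian_circle R r M \<and> M \<subseteq> intersection R r q1 q0 \<and>
        Pi_z ` M = curve q1 \<inter> region R r q1 q0"
    proof (intro exI conjI)
      have "m \<noteq> 0" using m by auto
      thus "(R - r) *\<^sub>R m \<noteq> (R + r) *\<^sub>R m" using R by simp
      show "curve q1 \<inter> region R r q1 q0 = closed_segment ((R - r) *\<^sub>R m) ((R + r) *\<^sub>R m)"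
        unfolding M(1) Pi_z_meridian[OF R(1) m] using R by (intro segment_of_multiples) simp
    qed (rule meridian_circle_meridian[OF R m] M(2) M(1)[symmetric])+
  }
  assume nk: "\<not> (\<exists>k. f = cst k * q1)"
  have "\<not> f dvd q1" using factor_of_linear_polynomial[OF assms(7,3,6)] nk by blast
  moreover have inf: "infinite (curve f)"
    using infinite_if_has_dimension_1[OF assms(9)] finite_Int by blast
  ultimately have nd: "\<not> f dvd sres1 R r q1 q0"
    by (intro not_dvd_sres1[OF R assms(7) fS])
  have "{v \<in> curve f. eval2 (sres1 R r q1 q0) v = 0} = curve f \<inter> curve (sres1 R r q1 q0)"
    by (auto simp: curve_def)
  thus "finite {v \<in> curve f. eval2 (sres1 R r q1 q0) v = 0}"
    using finite_common_zeros[OF assms(7) nd] by simp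
  note K = lifted_curve_is_component[OF S0_nonzero[OF R assms(5,6)] assms(7) fS inf nd]
  show "\<exists>K. irreducible_component K (intersection R r q1 q0) \<and>
      Pi_z ` K \<subseteq> curve f \<and>
      {w \<in> K. eval2 (sres1 R r q1 q0) (Pi_z w) \<noteq> 0}
        = lift R r q1 q0 ` {v \<in> curve f. eval2 (sres1 R r q1 q0) v \<noteq> 0} \<and>
      (\<forall>w\<in>K. tangential_at R r q1 q0 w)"
  proof (intro exI conjI ballI)
    fix w assume w: "w \<in> zariski_closure
      (lift R r q1 q0 ` {v \<in> curve f. eval2 (sres1 R r q1 q0) v \<noteq> 0})"
    have "eval3 (torus_poly R r) w = 0"
      using w K(1) unfolding irreducible_component_def by (auto simp: mem_intersection_iff)
    thus "tangential_at R r q1 q0 w" by (rule tangential_on_lifted_curve[OF R assms(8) w])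
  qed (rule K)+
qed

end
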